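(* Fix $0<p<2$ and $\eta>0$. Then $$\lim_{n\to\infty}\frac{R_n^*(M_{n,p}(\eta))}{\bar R_n^*(M_{n,p}(\eta))}=1.$$
   Context: Observations: $X_i\sim\mathrm{Exp}(\mu_i)$ independent (mean $\mu_i$), $i=1,\dots,n$, with $\mu_i\ge1$. $M_{n,p}(\eta)=\{\mu\in[1,\infty)^n:\frac1n\sum_i\log^p\mu_i\le\eta^p\}$. Minimax risk: $R_n^*(M_{n,p}(\eta))=\inf_{\hat\mu}\sup_{\mu\in M_{n,p}(\eta)}\mathbb{E}_\mu[\frac1n\|\log\hat\mu-\log\mu\|_2^2]$, infimum over estimators with values in $(0,\infty)^n$ (log taken coordinatewise). Minimax-Bayes risk: $\bar R_n^*(M_{n,p}(\eta))=\inf_{\hat\mu}\sup_\pi\{\mathbb{E}_\pi\mathbb{E}_\mu[\frac1n\|\log\hat\mu-\log\mu\|_2^2]:\ \mathbb{E}_\pi[\frac1n\sum_{i=1}^n\log^p\mu_i]\le\eta^p\}$, where the supremum is over prior distributions $\pi$ on $[1,\infty)^n$ for the random vector $\mu$, and given $\mu$ the $X_i$ are independent $\mathrm{Exp}(\mu_i)$. *)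

theory Defs
  imports "HOL-Probability.Probability"
begin

definition obs_model :: "nat \<Rightarrow> (nat \<Rightarrow> real) \<Rightarrow> (nat \<Rightarrow> real) measure" where
  "obs_model n \<mu> = PiM {..<n} (\<lambda>i. density lborel (exponential_density (1 / \<mu> i)))"

definition estimators :: "nat \<Rightarrow> ((nat \<Rightarrow> real) \<Rightarrow> (nat \<Rightarrow> real)) set" where
  "estimators n = {est. (\<forall>i<n. (\<lambda>x. est x i) \<in> borel_measurable (PiM {..<n} (\<lambda>_. lborel)))
                        \<and> (\<forall>x. \<forall>i<n. 0 < est x i)}"

definition log_loss :: "nat \<Rightarrow> (nat \<Rightarrow> real) \<Rightarrow> (nat \<Rightarrow> real) \<Rightarrow> real" where
  "log_loss n a \<mu> = (1 / real n) * (\<Sum>i<n. (ln (a i) - ln (\<mu> i))\<^sup>2)"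

definition risk :: "nat \<Rightarrow> ((nat \<Rightarrow> real) \<Rightarrow> (nat \<Rightarrow> real)) \<Rightarrow> (nat \<Rightarrow> real) \<Rightarrow> ennreal" where
  "risk n est \<mu> = (\<integral>\<^sup>+ x. ennreal (log_loss n (est x) \<mu>) \<partial>obs_model n \<mu>)"

definition Mset :: "nat \<Rightarrow> real \<Rightarrow> real \<Rightarrow> (nat \<Rightarrow> real) set" where
  "Mset n p \<eta> = {\<mu>. (\<forall>i<n. 1 \<le> \<mu> i) \<and>
                     (1 / real n) * (\<Sum>i<n. ln (\<mu> i) powr p) \<le> \<eta> powr p}"

definition priors :: "nat \<Rightarrow> real \<Rightarrow> real \<Rightarrow> (nat \<Rightarrow> real) measure set" where
  "priors n p \<eta> = {\<pi>. prob_space \<pi> \<and> sets \<pi> = sets (PiM {..<n} (\<lambda>_. borel :: real measure))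
      \<and> (AE \<mu> in \<pi>. \<forall>i<n. 1 \<le> \<mu> i)
      \<and> (\<integral>\<^sup>+ \<mu>. ennreal ((1 / real n) * (\<Sum>i<n. ln (\<mu> i) powr p)) \<partial>\<pi>) \<le> ennreal (\<eta> powr p)}"

definition bayes_risk :: "nat \<Rightarrow> ((nat \<Rightarrow> real) \<Rightarrow> (nat \<Rightarrow> real)) \<Rightarrow> (nat \<Rightarrow> real) measure \<Rightarrow> ennreal" where
  "bayes_risk n est \<pi> = (\<integral>\<^sup>+ \<mu>. risk n est \<mu> \<partial>\<pi>)"

definition minimax_risk :: "nat \<Rightarrow> real \<Rightarrow> real \<Rightarrow> ennreal" where
  "minimax_risk n p \<eta> = (INF est\<in>estimators n. SUP \<mu>\<in>Mset n p \<eta>. risk n est \<mu>)"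

definition minimax_bayes_risk :: "nat \<Rightarrow> real \<Rightarrow> real \<Rightarrow> ennreal" where
  "minimax_bayes_risk n p \<eta> = (INF est\<in>estimators n. SUP \<pi>\<in>priors n p \<eta>. bayes_risk n est \<pi>)"

end

theory Submission
  imports Defs
begin

text \<open>
  Both risks converge to the Bayes risk \<open>b\<close> of a least favourable prior of the one-dimensional problem.

  Priors obeying the moment constraint are tight. Clamping a decision rule to within distance \<open>A\<close> of
  \<open>ln x\<close> makes its risk bounded and continuous, at the cost of a tail that is small uniformly in the
  parameter. So by Helly's theorem a least favourable prior exists. Its posterior mean has Bayes
  risk at most \<open>b\<close> under every admissible prior, as one sees by mixing that prior into the least
  favourable one with vanishing weight. Used coordinatewise, the posterior mean shows that the
  minimax-Bayes risk is at most \<open>b\<close> for every \<open>n\<close>.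

  Conversely, truncating the least favourable prior and mixing it with the point mass at 1 gives a
  prior of bounded support with slack in the constraint and Bayes risk close to \<open>b\<close>. Its \<open>n\<close>-fold
  product concentrates on the parameter set by Hoeffding's inequality, so the minimax risk is
  eventually larger than any number below \<open>b\<close>.
\<close>

subsection \<open>Nonnegative integrals\<close>

lemma le_INF_add_ennreal:
  fixes a c :: ennreal
  assumes "\<And>x. x \<in> I \<Longrightarrow> a \<le> f x + c"
  shows "a \<le> (INF x\<in>I. f x) + c"
proof (cases "c = top")
  case False
  have "a - c \<le> (INF x\<in>I. f x)"
    using assms False by (intro INF_greatest) (auto simp: ennreal_minus_le_iff add.commute)
  then show ?thesis using False by (auto simp: ennreal_minus_le_iff add.commute)
qed simp

lemma less_mult_ennrealE:
  fixes c x :: ennreal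
  assumes "c < x"
  obtains s where "0 < s" "s < 1" "c < ennreal s * x"
proof -
  obtain a :: ennreal where a: "0 < a" "a < 1" "c < a * x"
    using assms ennreal_approx_unit[of x c] by (auto simp: not_le[symmetric])
  obtain s where s: "a = ennreal s" "0 \<le> s" using a(2) by (cases a) auto
  then show ?thesis using a by (intro that[of s]) auto
qed

lemma nn_integral_mean:
  assumes n: "0 < n" and nonneg: "\<And>i x. i < n \<Longrightarrow> 0 \<le> f i x" and f: "\<And>i. i < n \<Longrightarrow> f i \<in> borel_measurable M"
  shows "(\<integral>\<^sup>+ x. ennreal ((1 / real n) * (\<Sum>i<n. f i x)) \<partial>M) =
      (\<Sum>i<n. \<integral>\<^sup>+ x. ennreal (f i x) \<partial>M) / ennreal (real n)"
proof -
  have "ennreal ((1 / real n) * (\<Sum>i<n. f i x)) = (\<Sum>i<n. ennreal (f i x)) / ennreal (real n)" for x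
    using n nonneg by (subst sum_ennreal) (auto intro!: divide_ennreal[symmetric] sum_nonneg)
  then have "(\<integral>\<^sup>+ x. ennreal ((1 / real n) * (\<Sum>i<n. f i x)) \<partial>M) =
      (\<integral>\<^sup>+ x. (\<Sum>i<n. ennreal (f i x)) / ennreal (real n) \<partial>M)"
    by simp
  also have "\<dots> = (\<integral>\<^sup>+ x. (\<Sum>i<n. ennreal (f i x)) \<partial>M) / ennreal (real n)"
    using f by (intro nn_integral_divide borel_measurable_sum) auto
  also have "(\<integral>\<^sup>+ x. (\<Sum>i<n. ennreal (f i x)) \<partial>M) = (\<Sum>i<n. \<integral>\<^sup>+ x. ennreal (f i x) \<partial>M)"
    using f by (intro nn_integral_sum) auto
  finally show ?thesis .
qed

subsection \<open>Mixtures\<close>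

definition mixture :: "'i pmf \<Rightarrow> ('i \<Rightarrow> 'a measure) \<Rightarrow> 'a measure" where
  "mixture q \<mu> = measure_pmf q \<bind> \<mu>"

context
  fixes \<mu> :: "'i \<Rightarrow> 'a measure" and N :: "'a measure"
  assumes prob: "\<And>i. prob_space (\<mu> i)" and sets: "\<And>i. sets (\<mu> i) = sets N"
begin

lemma measurable_mixture_kernel: "\<mu> \<in> measurable (measure_pmf q) (subprob_algebra N)"
  using prob sets by (auto simp: space_subprob_algebra intro: prob_space_imp_subprob_space)

lemma sets_mixture: "sets (mixture q \<mu>) = sets N"
  unfolding mixture_def by (rule sets_bind) (auto simp: sets)

lemma prob_space_mixture: "prob_space (mixture q \<mu>)"
  unfolding mixture_def
  by (rule measure_pmf.prob_space_bind[OF _ measurable_mixture_kernel]) (simp add: prob)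

lemma nn_integral_mixture:
  "f \<in> borel_measurable N \<Longrightarrow> (\<integral>\<^sup>+ x. f x \<partial>mixture q \<mu>) = (\<integral>\<^sup>+ i. \<integral>\<^sup>+ x. f x \<partial>\<mu> i \<partial>measure_pmf q)"
  unfolding mixture_def by (rule nn_integral_bind[OF _ measurable_mixture_kernel])

lemma AE_mixture_iff:
  "Measurable.pred N P \<Longrightarrow> (AE x in mixture q \<mu>. P x) \<longleftrightarrow> (\<forall>i\<in>set_pmf q. AE x in \<mu> i. P x)"
  unfolding mixture_def by (simp add: AE_bind[OF measurable_mixture_kernel] AE_measure_pmf_iff)

end

definition mix :: "real \<Rightarrow> 'a measure \<Rightarrow> 'a measure \<Rightarrow> 'a measure" where
  "mix t \<mu> \<nu> = mixture (bernoulli_pmf t) (\<lambda>b. if b then \<mu> else \<nu>)"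

context
  fixes \<mu> \<nu> N :: "'a measure" and t :: real
  assumes prob: "prob_space \<mu>" "prob_space \<nu>" and sets: "sets \<mu> = sets N" "sets \<nu> = sets N"
    and t: "t \<in> {0..1}"
begin

lemma prob_sets_branch:
  "prob_space (if b then \<mu> else \<nu>)" "sets (if b then \<mu> else \<nu>) = sets N"
  using prob sets by auto

lemma sets_mix: "sets (mix t \<mu> \<nu>) = sets N"
  unfolding mix_def by (rule sets_mixture[OF prob_sets_branch])

lemma prob_space_mix: "prob_space (mix t \<mu> \<nu>)"
  unfolding mix_def by (rule prob_space_mixture[OF prob_sets_branch])

lemma nn_integral_mix:
  assumes "f \<in> borel_measurable N"
  shows "(\<integral>\<^sup>+ x. f x \<partial>mix t \<mu> \<nu>) = ennreal t * (\<integral>\<^sup>+ x. f x \<partial>\<mu>) + ennreal (1 - t) * (\<integral>\<^sup>+ x. f x \<partial>\<nu>)"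
  unfolding mix_def using assms t by (simp add: nn_integral_mixture[OF prob_sets_branch] mult.commute)

lemma AE_mix:
  assumes "Measurable.pred N P" "AE x in \<mu>. P x" "AE x in \<nu>. P x"
  shows "AE x in mix t \<mu> \<nu>. P x"
  unfolding mix_def by (subst AE_mixture_iff[OF prob_sets_branch assms(1)]) (use assms in auto)

lemma integral_mix:
  fixes f :: "'a \<Rightarrow> real"
  assumes [measurable]: "f \<in> borel_measurable N" and f: "integrable \<mu> f" "integrable \<nu> f"
    and nonneg: "AE x in \<mu>. 0 \<le> f x" "AE x in \<nu>. 0 \<le> f x"
  shows "integral\<^sup>L (mix t \<mu> \<nu>) f = t * integral\<^sup>L \<mu> f + (1 - t) * integral\<^sup>L \<nu> f"
proof -
  have "(\<integral>\<^sup>+ x. ennreal (f x) \<partial>mix t \<mu> \<nu>) =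
      ennreal t * ennreal (integral\<^sup>L \<mu> f) + ennreal (1 - t) * ennreal (integral\<^sup>L \<nu> f)"
    by (subst nn_integral_mix) (simp_all add: nn_integral_eq_integral f nonneg)
  also have "\<dots> = ennreal (t * integral\<^sup>L \<mu> f + (1 - t) * integral\<^sup>L \<nu> f)"
    using t by (simp add: ennreal_mult integral_nonneg_AE nonneg)
  finally have "enn2real (\<integral>\<^sup>+ x. ennreal (f x) \<partial>mix t \<mu> \<nu>) =
      t * integral\<^sup>L \<mu> f + (1 - t) * integral\<^sup>L \<nu> f"
    using t by (simp add: integral_nonneg_AE nonneg del: ennreal_plus)
  moreover have "f \<in> borel_measurable (mix t \<mu> \<nu>)"
    by (simp add: sets_mix cong: measurable_cong_sets)
  moreover have "AE x in mix t \<mu> \<nu>. 0 \<le> f x"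
    by (intro AE_mix nonneg) measurable
  ultimately show ?thesis
    by (simp add: integral_eq_nn_integral)
qed

end

subsection \<open>Weighted means\<close>

definition weighted_mean :: "'a measure \<Rightarrow> ('a \<Rightarrow> real) \<Rightarrow> ('a \<Rightarrow> real) \<Rightarrow> real" where
  "weighted_mean M w g = (LINT x|M. g x * w x) / (LINT x|M. w x)"

lemma nn_integral_weighted_square:
  assumes w: "AE x in M. 0 \<le> w x"
    and int: "integrable M w" "integrable M (\<lambda>x. g x * w x)" "integrable M (\<lambda>x. (g x)\<^sup>2 * w x)"
  shows "(\<integral>\<^sup>+ x. ennreal (w x) * ennreal ((a - g x)\<^sup>2) \<partial>M) =
    ennreal (a\<^sup>2 * (LINT x|M. w x) - 2 * a * (LINT x|M. g x * w x) + (LINT x|M. (g x)\<^sup>2 * w x))"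
proof -
  have expand: "w x * (a - g x)\<^sup>2 = a\<^sup>2 * w x - 2 * a * (g x * w x) + (g x)\<^sup>2 * w x" for x
    by (simp add: power2_eq_square algebra_simps)
  have "(\<integral>\<^sup>+ x. ennreal (w x) * ennreal ((a - g x)\<^sup>2) \<partial>M) = (\<integral>\<^sup>+ x. ennreal (w x * (a - g x)\<^sup>2) \<partial>M)"
    by (simp add: ennreal_mult'')
  also have "\<dots> = ennreal (LINT x|M. w x * (a - g x)\<^sup>2)"
  proof (rule nn_integral_eq_integral)
    show "integrable M (\<lambda>x. w x * (a - g x)\<^sup>2)"
      unfolding expand using int by simp
    show "AE x in M. 0 \<le> w x * (a - g x)\<^sup>2"
      using w by eventually_elim simp
  qed
  finally show ?thesis
    unfolding expand using int by simp
qed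

lemma weighted_mean_minimizes:
  assumes w: "AE x in M. 0 \<le> w x" "0 < (LINT x|M. w x)"
    and int: "integrable M w" "integrable M (\<lambda>x. g x * w x)" "integrable M (\<lambda>x. (g x)\<^sup>2 * w x)"
  shows "(\<integral>\<^sup>+ x. ennreal (w x) * ennreal ((weighted_mean M w g - g x)\<^sup>2) \<partial>M)
    \<le> (\<integral>\<^sup>+ x. ennreal (w x) * ennreal ((a - g x)\<^sup>2) \<partial>M)"
proof -
  define D N where "D = (LINT x|M. w x)" and "N = (LINT x|M. g x * w x)"
  have "0 < D" using w(2) by (simp add: D_def)
  then have "0 \<le> D * (a - N / D)\<^sup>2" by simp
  also have "\<dots> = (a\<^sup>2 * D - 2 * a * N) - ((N / D)\<^sup>2 * D - 2 * (N / D) * N)"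
    using \<open>0 < D\<close> by (simp add: power2_eq_square field_simps)
  finally show ?thesis
    unfolding nn_integral_weighted_square[OF w(1) int]
    by (intro ennreal_leI) (simp add: weighted_mean_def D_def N_def)
qed

subsection \<open>Weak limits\<close>

context
  fixes \<mu> :: "nat \<Rightarrow> real measure" and M :: "real measure"
  assumes \<mu>: "\<And>k. real_distribution (\<mu> k)" and M: "real_distribution M" and conv: "weak_conv_m \<mu> M"
begin

lemma weak_conv_imp_nn_integral_bdd_continuous_conv:
  assumes cont: "\<And>x. isCont f x" and bdd: "\<And>x. 0 \<le> f x" "\<And>x. f x \<le> B"
  shows "(\<lambda>k. \<integral>\<^sup>+ x. ennreal (f x) \<partial>\<mu> k) \<longlonglongrightarrow> (\<integral>\<^sup>+ x. ennreal (f x) \<partial>M)"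
proof -
  have "(\<integral>\<^sup>+ x. ennreal (f x) \<partial>D) = ennreal (integral\<^sup>L D f)" if "real_distribution D" for D
  proof -
    interpret real_distribution D by fact
    have "f \<in> borel_measurable borel"
      using cont by (intro borel_measurable_continuous_onI continuous_at_imp_continuous_on) auto
    then have "integrable D f"
      using bdd by (intro integrable_const_bound[where B=B]) auto
    then show ?thesis using bdd by (intro nn_integral_eq_integral) auto
  qed
  moreover have "(\<lambda>k. integral\<^sup>L (\<mu> k) f) \<longlonglongrightarrow> integral\<^sup>L M f"
    using bdd
    by (intro weak_conv_imp_integral_bdd_continuous_conv[OF \<mu> M conv, where B=B] cont) simp
  ultimately show ?thesis
    using \<mu> M by (simp add: tendsto_ennrealI)
qed

lemma weak_conv_nn_integral_le:
  assumes cont: "\<And>x. isCont f x" and nonneg: "\<And>x. 0 \<le> f x"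
    and integral_le: "\<And>k. (\<integral>\<^sup>+ x. ennreal (f x) \<partial>\<mu> k) \<le> C"
  shows "(\<integral>\<^sup>+ x. ennreal (f x) \<partial>M) \<le> C"
proof -
  interpret real_distribution M by (rule M)
  have [measurable]: "f \<in> borel_measurable borel"
    using cont by (auto intro!: borel_measurable_continuous_onI continuous_at_imp_continuous_on)
  have truncated_le: "(\<integral>\<^sup>+ x. ennreal (min (real n) (f x)) \<partial>M) \<le> C" for n
  proof (rule LIMSEQ_le_const2)
    show "(\<lambda>k. \<integral>\<^sup>+ x. ennreal (min (real n) (f x)) \<partial>\<mu> k) \<longlonglongrightarrow> (\<integral>\<^sup>+ x. ennreal (min (real n) (f x)) \<partial>M)"
      by (rule weak_conv_imp_nn_integral_bdd_continuous_conv[where B="real n"])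
         (auto intro!: continuous_intros cont nonneg)
    have "(\<integral>\<^sup>+ x. ennreal (min (real n) (f x)) \<partial>\<mu> k) \<le> C" for k
      by (rule order_trans[OF nn_integral_mono integral_le[of k]]) (auto intro: ennreal_leI)
    then show "\<exists>K. \<forall>k\<ge>K. (\<integral>\<^sup>+ x. ennreal (min (real n) (f x)) \<partial>\<mu> k) \<le> C" by blast
  qed
  have "(\<integral>\<^sup>+ x. ennreal (f x) \<partial>M) = (\<integral>\<^sup>+ x. liminf (\<lambda>n. ennreal (min (real n) (f x))) \<partial>M)"
  proof (intro nn_integral_cong lim_imp_Liminf[symmetric] tendsto_eventually)
    fix x
    show "\<forall>\<^sub>F n in sequentially. ennreal (min (real n) (f x)) = ennreal (f x)"
      by (rule eventually_sequentiallyI[of "nat \<lceil>f x\<rceil>"]) (auto simp: min_def nat_le_iff ceiling_le_iff)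
  qed simp
  also have "\<dots> \<le> liminf (\<lambda>n. \<integral>\<^sup>+ x. ennreal (min (real n) (f x)) \<partial>M)"
    by (rule nn_integral_liminf) simp
  also have "\<dots> \<le> C"
    using truncated_le by (intro order_trans[OF Liminf_le_Limsup] Limsup_bounded) auto
  finally show ?thesis .
qed

lemma weak_conv_AE_ge:
  assumes AE_ge: "\<And>k. AE x in \<mu> k. a \<le> x"
  shows "AE x in M. a \<le> x"
proof -
  interpret real_distribution M by (rule M)
  have "(\<integral>\<^sup>+ x. ennreal (max 0 (a - x)) \<partial>M) \<le> 0"
  proof (rule weak_conv_nn_integral_le)
    have "(\<integral>\<^sup>+ x. ennreal (max 0 (a - x)) \<partial>\<mu> k) = (\<integral>\<^sup>+ x. 0 \<partial>\<mu> k)" for k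
      using AE_ge[of k] by (intro nn_integral_cong_AE) (auto elim!: eventually_mono simp: ennreal_neg)
    then show "(\<integral>\<^sup>+ x. ennreal (max 0 (a - x)) \<partial>\<mu> k) \<le> 0" for k by simp
  qed (auto intro!: continuous_intros)
  then have "AE x in M. ennreal (max 0 (a - x)) = 0"
    by (subst (asm) le_zero_eq, subst (asm) nn_integral_0_iff_AE) simp_all
  then show ?thesis
    by eventually_elim (simp add: ennreal_eq_0_iff)
qed

end

subsection \<open>Finite products\<close>

lemma measurable_PiM_borel_component:
  fixes f :: "'a \<Rightarrow> 'i \<Rightarrow> 'b::topological_space"
  assumes f: "f \<in> measurable M (PiM I (\<lambda>_. borel))"
  shows "(\<lambda>x. f x i) \<in> borel_measurable M"
proof (cases "i \<in> I")
  case True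
  then show ?thesis by (rule measurable_compose[OF f measurable_component_singleton])
next
  case False
  then have "f x i = undefined" if "x \<in> space M" for x
    using measurable_space[OF f that] by (auto simp: space_PiM PiE_iff extensional_def)
  then show ?thesis
    by (subst measurable_cong[where g="\<lambda>_. undefined"]) simp_all
qed

lemma nn_integral_PiM_component:
  assumes "\<And>i. i \<in> I \<Longrightarrow> prob_space (M i)" "i \<in> I" "f \<in> borel_measurable (M i)"
  shows "(\<integral>\<^sup>+ x. f (x i) \<partial>PiM I M) = (\<integral>\<^sup>+ y. f y \<partial>M i)"
proof -
  have "(\<integral>\<^sup>+ y. f y \<partial>M i) = (\<integral>\<^sup>+ y. f y \<partial>distr (PiM I M) (M i) (\<lambda>x. x i))"
    using assms by (simp add: distr_PiM_component)
  also have "\<dots> = (\<integral>\<^sup>+ x. f (x i) \<partial>PiM I M)"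
    using assms by (intro nn_integral_distr measurable_component_singleton) auto
  finally show ?thesis ..
qed

lemma AE_PiM_finite:
  assumes "finite I" "\<And>i. i \<in> I \<Longrightarrow> prob_space (M i)" "\<And>i. i \<in> I \<Longrightarrow> AE x in M i. Q i x"
  shows "AE x in PiM I M. \<forall>i\<in>I. Q i (x i)"
  using assms by (intro eventually_ball_finite ballI AE_PiM_component)

lemma distr_PiM_componentwise:
  assumes "finite I" and M: "\<And>i. prob_space (M i)" and f [measurable]: "\<And>i. f i \<in> measurable (M i) (N i)"
  shows "distr (PiM I M) (PiM I N) (\<lambda>x. \<lambda>i\<in>I. f i (x i)) = PiM I (\<lambda>i. distr (M i) (N i) (f i))"
proof -
  interpret M: product_prob_space M
    by (rule product_prob_spaceI) (rule M)
  interpret D: product_prob_space "\<lambda>i. distr (M i) (N i) (f i)"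
    by (rule product_prob_spaceI) (intro prob_space.prob_space_distr M f)
  let ?F = "\<lambda>x. \<lambda>i\<in>I. f i (x i)"
  have F: "?F \<in> measurable (PiM I M) (PiM I N)"
    by (rule measurable_restrict) measurable
  show ?thesis
  proof (rule D.PiM_eqI[OF \<open>finite I\<close>])
    show "sets (distr (PiM I M) (PiM I N) ?F) = sets (PiM I (\<lambda>i. distr (M i) (N i) (f i)))"
      by (simp cong: sets_PiM_cong)
    fix A assume "\<And>i. i \<in> I \<Longrightarrow> A i \<in> sets (distr (M i) (N i) (f i))"
    then have A: "A i \<in> sets (N i)" if "i \<in> I" for i using that by simp
    have "emeasure (distr (PiM I M) (PiM I N) ?F) (Pi\<^sub>E I A) =
        emeasure (PiM I M) (?F -` Pi\<^sub>E I A \<inter> space (PiM I M))"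
      using \<open>finite I\<close> A by (intro emeasure_distr F) auto
    also have "?F -` Pi\<^sub>E I A \<inter> space (PiM I M) = (\<Pi>\<^sub>E i\<in>I. f i -` A i \<inter> space (M i))"
      by (auto simp: space_PiM PiE_iff)
    also have "emeasure (PiM I M) \<dots> = (\<Prod>i\<in>I. emeasure (M i) (f i -` A i \<inter> space (M i)))"
      using f A by (intro M.emeasure_PiM \<open>finite I\<close>) auto
    also have "\<dots> = (\<Prod>i\<in>I. emeasure (distr (M i) (N i) (f i)) (A i))"
      using f A by (intro prod.cong refl) (simp add: emeasure_distr)
    finally show "emeasure (distr (PiM I M) (PiM I N) ?F) (Pi\<^sub>E I A) =
        (\<Prod>i\<in>I. emeasure (distr (M i) (N i) (f i)) (A i))" .
  qed
qed

lemma nn_integral_PiM_insert_pair: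
  assumes M: "\<And>i. prob_space (M i)" and N: "\<And>i. prob_space (N i)" and J: "finite J" "i \<notin> J"
    and F: "(\<lambda>(x, y). F x y) \<in> borel_measurable (PiM (insert i J) M \<Otimes>\<^sub>M PiM (insert i J) N)"
  shows "(\<integral>\<^sup>+ x. \<integral>\<^sup>+ y. F x y \<partial>PiM (insert i J) N \<partial>PiM (insert i J) M) =
    (\<integral>\<^sup>+ x. \<integral>\<^sup>+ y. \<integral>\<^sup>+ s. \<integral>\<^sup>+ t. F (x(i := s)) (y(i := t)) \<partial>N i \<partial>M i \<partial>PiM J N \<partial>PiM J M)"
proof -
  interpret M: product_prob_space M by (rule product_prob_spaceI) (rule M)
  interpret N: product_prob_space N by (rule product_prob_spaceI) (rule N)
  interpret NI: prob_space "PiM (insert i J) N" by (rule prob_space_PiM) (rule N)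
  interpret NJ: prob_space "PiM J N" by (rule prob_space_PiM) (rule N)
  interpret swap: pair_sigma_finite "M i" "PiM J N" ..
  have measurable_upd: "(\<lambda>z. (f z)(i := g z)) \<in> measurable L (PiM (insert i J) K)"
    if "f \<in> measurable L (PiM J K)" "g \<in> measurable L (K i)"
    for f g and L :: "'z measure" and K :: "'a \<Rightarrow> 'y measure"
    by (rule measurable_fun_upd[where J=J]) (use that in auto)
  have measurable_F: "(\<lambda>z. F (f z) (g z)) \<in> borel_measurable L"
    if "f \<in> measurable L (PiM (insert i J) M)" "g \<in> measurable L (PiM (insert i J) N)"
    for f g and L :: "'z measure"
    using measurable_compose[OF measurable_Pair[OF that] F] by simp
  have "(\<integral>\<^sup>+ x. \<integral>\<^sup>+ y. F x y \<partial>PiM (insert i J) N \<partial>PiM (insert i J) M) =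
      (\<integral>\<^sup>+ x. \<integral>\<^sup>+ s. \<integral>\<^sup>+ y. F (x(i := s)) y \<partial>PiM (insert i J) N \<partial>M i \<partial>PiM J M)"
    using F by (intro M.product_nn_integral_insert J) simp
  also have "\<dots> = (\<integral>\<^sup>+ x. \<integral>\<^sup>+ s. \<integral>\<^sup>+ y. \<integral>\<^sup>+ t. F (x(i := s)) (y(i := t)) \<partial>N i \<partial>PiM J N \<partial>M i \<partial>PiM J M)"
  proof (intro nn_integral_cong N.product_nn_integral_insert J)
    fix x s assume "x \<in> space (PiM J M)" "s \<in> space (M i)"
    then have "x(i := s) \<in> space (PiM (insert i J) M)"
      by (auto simp: space_PiM PiE_iff extensional_def)
    then show "(\<lambda>y. F (x(i := s)) y) \<in> borel_measurable (PiM (insert i J) N)"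
      by (intro measurable_F measurable_const) simp_all
  qed
  also have "\<dots> = (\<integral>\<^sup>+ x. \<integral>\<^sup>+ y. \<integral>\<^sup>+ s. \<integral>\<^sup>+ t. F (x(i := s)) (y(i := t)) \<partial>N i \<partial>M i \<partial>PiM J N \<partial>PiM J M)"
  proof (rule nn_integral_cong)
    fix x assume "x \<in> space (PiM J M)"
    then have "(\<lambda>w. F (x(i := fst (fst w))) ((snd (fst w))(i := snd w))) \<in>
        borel_measurable ((M i \<Otimes>\<^sub>M PiM J N) \<Otimes>\<^sub>M N i)"
      by (intro measurable_F measurable_upd measurable_const) measurable
    then have "(\<lambda>(s, y). \<integral>\<^sup>+ t. F (x(i := s)) (y(i := t)) \<partial>N i) \<in> borel_measurable (M i \<Otimes>\<^sub>M PiM J N)"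
      by (simp add: case_prod_beta' N.M.borel_measurable_nn_integral)
    then show "(\<integral>\<^sup>+ s. \<integral>\<^sup>+ y. \<integral>\<^sup>+ t. F (x(i := s)) (y(i := t)) \<partial>N i \<partial>PiM J N \<partial>M i) =
        (\<integral>\<^sup>+ y. \<integral>\<^sup>+ s. \<integral>\<^sup>+ t. F (x(i := s)) (y(i := t)) \<partial>N i \<partial>M i \<partial>PiM J N)"
      by (rule swap.Fubini'[symmetric])
  qed
  finally show ?thesis .
qed

lemma indep_vars_PiM_components:
  assumes "I \<noteq> {}" and M: "\<And>i. i \<in> I \<Longrightarrow> prob_space (M i)"
  shows "prob_space.indep_vars (PiM I M) M (\<lambda>i x. x i) I"
proof -
  interpret prob_space "PiM I M" by (rule prob_space_PiM) (rule M)
  have "distr (PiM I M) (PiM I M) (\<lambda>x. \<lambda>i\<in>I. x i) = distr (PiM I M) (PiM I M) (\<lambda>x. x)"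
    by (rule distr_cong) (auto simp: space_PiM)
  also have "\<dots> = PiM I M" by (rule distr_id)
  also have "\<dots> = PiM I (\<lambda>i. distr (PiM I M) (M i) (\<lambda>x. x i))"
    by (rule PiM_cong) (simp_all add: distr_PiM_component M)
  finally show ?thesis
    using \<open>I \<noteq> {}\<close> by (subst indep_vars_iff_distr_eq_PiM') auto
qed

lemma (in prob_space) Hoeffding_PiM:
  fixes f :: "'a \<Rightarrow> real"
  assumes f [measurable]: "f \<in> borel_measurable M" and bounded: "AE x in M. f x \<in> {a..b}" and "a < b"
    and n: "0 < n" and \<epsilon>: "0 \<le> \<epsilon>"
  shows "measure (PiM {..<n} (\<lambda>_. M))
      {x \<in> space (PiM {..<n} (\<lambda>_. M)). expectation f + \<epsilon> \<le> (\<Sum>i<n. f (x i)) / real n}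
    \<le> exp (- 2 * real n * \<epsilon>\<^sup>2 / (b - a)\<^sup>2)"
proof -
  let ?P = "PiM {..<n} (\<lambda>_. M)"
  interpret P: prob_space ?P by (rule prob_space_PiM) (rule prob_space_axioms)
  have component [measurable]: "(\<lambda>x. x i) \<in> measurable ?P M" if "i < n" for i
    using that by (intro measurable_component_singleton) simp
  have distr_component: "distr ?P M (\<lambda>x. x i) = M" if "i < n" for i
    using that by (intro distr_PiM_component) (auto simp: prob_space_axioms)
  have distr_f: "distr ?P borel (\<lambda>x. f (x i)) = distr M borel f" if "i < n" for i
    using distr_distr[OF f component[OF that]] by (simp add: comp_def distr_component[OF that])
  have "P.indep_vars (\<lambda>_. M) (\<lambda>i x. x i) {..<n}"
    using n by (intro indep_vars_PiM_components prob_space_axioms) auto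
  then have indep: "P.indep_vars (\<lambda>_. borel) (\<lambda>i x. f (x i)) {..<n}"
    by (rule P.indep_vars_compose2) simp
  interpret Hoeffding_ineq_iid ?P "{..<n}" "\<lambda>i x. f (x i)" "\<lambda>x. f (x 0)" a b
    "P.expectation (\<lambda>x. f (x 0))"
  proof unfold_locales
    show "AE x in ?P. f (x 0) \<in> {a..b}"
      using n bounded
      by (intro AE_PiM_component[where P="\<lambda>y. f y \<in> {a..b}"])
         (auto simp: prob_space_axioms)
    show "(\<lambda>x. f (x 0)) \<in> borel_measurable ?P"
      by (rule measurable_compose[OF component[OF n] f])
  qed (use indep distr_f n in auto)
  have "P.expectation (\<lambda>x. f (x 0)) = integral\<^sup>L (distr ?P M (\<lambda>x. x 0)) f"
    by (rule integral_distr[OF component[OF n] f, symmetric])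
  also have "\<dots> = expectation f"
    by (simp add: distr_component[OF n])
  finally have "P.expectation (\<lambda>x. f (x 0)) = expectation f" .
  moreover have "{..<n} \<noteq> {}" using n by auto
  ultimately show ?thesis
    using Hoeffding_ineq_ge'[OF \<epsilon> \<open>a < b\<close>] by simp
qed

subsection \<open>The scalar problem\<close>

definition exponential :: "real \<Rightarrow> real measure" where
  "exponential m = density lborel (\<lambda>x. ennreal (exponential_density (1 / m) x))"

definition scalar_risk :: "(real \<Rightarrow> real) \<Rightarrow> real \<Rightarrow> ennreal" where
  "scalar_risk d m = (\<integral>\<^sup>+ x. ennreal ((d x - ln m)\<^sup>2) \<partial>exponential m)"

definition scalar_bayes_risk :: "(real \<Rightarrow> real) \<Rightarrow> real measure \<Rightarrow> ennreal" where
  "scalar_bayes_risk d \<pi> = (\<integral>\<^sup>+ m. scalar_risk d m \<partial>\<pi>)"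

definition min_bayes_risk :: "real measure \<Rightarrow> ennreal" where
  "min_bayes_risk \<pi> = (INF d\<in>borel_measurable borel. scalar_bayes_risk d \<pi>)"

lemma min_bayes_risk_le: "d \<in> borel_measurable borel \<Longrightarrow> min_bayes_risk \<pi> \<le> scalar_bayes_risk d \<pi>"
  unfolding min_bayes_risk_def by (rule INF_lower)

lemma sets_exponential [simp, measurable_cong]: "sets (exponential m) = sets borel"
  by (simp add: exponential_def)

lemma prob_space_exponential: "0 < m \<Longrightarrow> prob_space (exponential m)"
  unfolding exponential_def by (rule prob_space_exponential_density) simp

lemma nn_integral_exponential:
  assumes [measurable]: "f \<in> borel_measurable borel"
  shows "(\<integral>\<^sup>+ x. f x \<partial>exponential m) = (\<integral>\<^sup>+ x. ennreal (exponential_density (1 / m) x) * f x \<partial>lborel)"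
  unfolding exponential_def by (subst nn_integral_density) auto

lemma AE_exponential_iff:
  assumes "0 < m"
  shows "(AE x in exponential m. P x) \<longleftrightarrow> (AE x in lborel. 0 < x \<longrightarrow> P x)"
proof -
  have "(AE x in exponential m. P x) \<longleftrightarrow> (AE x in lborel. 0 \<le> x \<longrightarrow> P x)"
    unfolding exponential_def using assms
    by (subst AE_density) (auto simp: exponential_density_def not_less intro!: AE_cong)
  also have "\<dots> \<longleftrightarrow> (AE x in lborel. 0 < x \<longrightarrow> P x)"
    using AE_lborel_singleton[of "0::real"] by (auto elim!: eventually_elim2)
  finally show ?thesis .
qed

lemma AE_exponential_pos: "0 < m \<Longrightarrow> AE x in exponential m. 0 < x"
  by (simp add: AE_exponential_iff)

lemma exponential_eq_distr:
  assumes "0 < m"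
  shows "exponential m = distr (exponential 1) borel (\<lambda>e. m * e)"
proof (rule measure_eqI)
  fix A assume "A \<in> sets (exponential m)"
  then have A [measurable]: "A \<in> sets borel" by simp
  have "emeasure (exponential m) A =
      (\<integral>\<^sup>+ x. ennreal (exponential_density (1 / m) x) * indicator A x \<partial>lborel)"
    by (simp flip: nn_integral_exponential)
  also have "\<dots> =
      ennreal m * (\<integral>\<^sup>+ x. ennreal (exponential_density (1 / m) (m * x)) * indicator A (m * x) \<partial>lborel)"
    using assms by (subst nn_integral_real_affine[where c=m and t=0]) auto
  also have "\<dots> = (\<integral>\<^sup>+ x. ennreal (exponential_density (1 / 1) x) * indicator A (m * x) \<partial>lborel)"
    using assms
    by (subst nn_integral_cmult[symmetric])
       (auto intro!: nn_integral_cong split: split_indicator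
             simp: exponential_density_def ennreal_mult[symmetric] mult_less_0_iff)
  also have "\<dots> = (\<integral>\<^sup>+ x. indicator A (m * x) \<partial>exponential 1)"
    by (rule nn_integral_exponential[symmetric]) simp
  also have "\<dots> = (\<integral>\<^sup>+ x. indicator A x \<partial>distr (exponential 1) borel (\<lambda>e. m * e))"
    by (subst nn_integral_distr) auto
  finally show "emeasure (exponential m) A = emeasure (distr (exponential 1) borel (\<lambda>e. m * e)) A"
    by simp
qed simp

lemma scalar_risk_eq_scaled:
  assumes "0 < m" and [measurable]: "d \<in> borel_measurable borel"
  shows "scalar_risk d m = (\<integral>\<^sup>+ e. ennreal ((d (m * e) - ln m)\<^sup>2) \<partial>exponential 1)"
  unfolding scalar_risk_def exponential_eq_distr[OF assms(1)] by (subst nn_integral_distr) auto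

lemma scalar_risk_eq_density:
  assumes [measurable]: "d \<in> borel_measurable borel"
  shows "scalar_risk d m =
    (\<integral>\<^sup>+ x. ennreal (exponential_density (1 / m) x) * ennreal ((d x - ln m)\<^sup>2) \<partial>lborel)"
  unfolding scalar_risk_def by (rule nn_integral_exponential) simp

lemma measurable_scalar_risk [measurable]:
  assumes [measurable]: "d \<in> borel_measurable borel"
  shows "scalar_risk d \<in> borel_measurable borel"
  unfolding scalar_risk_eq_density[OF assms, abs_def] exponential_density_def by measurable

lemma scalar_risk_eq_0_iff:
  assumes [measurable]: "d \<in> borel_measurable borel" and "0 < m"
  shows "scalar_risk d m = 0 \<longleftrightarrow> (AE x in lborel. 0 < x \<longrightarrow> d x = ln m)"
  unfolding scalar_risk_def
  by (subst nn_integral_0_iff_AE, measurable) (simp add: AE_exponential_iff assms)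

subsection \<open>Square integrability of the logarithm\<close>

lemma nn_integral_powr_exponential:
  assumes "- 1 < s"
  shows "(\<integral>\<^sup>+ x. ennreal (x powr s) \<partial>exponential 1) = ennreal (Gamma (s + 1))"
proof -
  have "(\<integral>\<^sup>+ x. ennreal (x powr s) \<partial>exponential 1) =
      (\<integral>\<^sup>+ x. ennreal (exponential_density (1 / 1) x) * ennreal (x powr s) \<partial>lborel)"
    by (rule nn_integral_exponential) simp
  also have "\<dots> = (\<integral>\<^sup>+ x. ennreal (indicator {0..} x * x powr (s + 1 - 1) / exp x) \<partial>lborel)"
    by (intro nn_integral_cong)
       (auto simp: exponential_density_def exp_minus divide_inverse mult.commute
             simp flip: ennreal_mult split: split_indicator)
  also have "\<dots> = ennreal (Gamma (s + 1))"
    using assms by (intro Gamma_conv_nn_integral_real[symmetric]) simp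
  finally show ?thesis .
qed

lemma ln_squared_le_powr:
  assumes "0 < (x::real)"
  shows "(ln x)\<^sup>2 \<le> 16 * (x powr (1/2) + x powr (-1/2))"
proof -
  have ge_1: "(ln y)\<^sup>2 \<le> 16 * y powr (1/2)" if "1 \<le> y" for y :: real
  proof -
    have "ln y \<le> y powr (1/4) / (1/4)"
      using that by (intro ln_powr_bound) auto
    then have "(ln y)\<^sup>2 \<le> (4 * y powr (1/4))\<^sup>2"
      using that by (intro power_mono) auto
    also have "\<dots> = 16 * y powr (1/2)"
      using that by (simp add: power2_eq_square powr_add[symmetric])
    finally show ?thesis .
  qed
  show ?thesis
  proof (cases "1 \<le> x")
    case True
    then have "(ln x)\<^sup>2 \<le> 16 * x powr (1/2)" by (rule ge_1)
    also have "\<dots> \<le> 16 * (x powr (1/2) + x powr (-1/2))" by simp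
    finally show ?thesis .
  next
    case False
    have "(ln x)\<^sup>2 = (ln (inverse x))\<^sup>2"
      using assms by (simp add: ln_inverse)
    also have "\<dots> \<le> 16 * (inverse x) powr (1/2)"
      using False assms by (intro ge_1) (simp add: one_le_inverse)
    also have "(inverse x) powr (1/2) = x powr (-1/2)"
      using assms by (simp add: powr_minus inverse_powr)
    also have "16 * x powr (-1/2) \<le> 16 * (x powr (1/2) + x powr (-1/2))" by simp
    finally show ?thesis .
  qed
qed

lemma integrable_ln_squared_exponential_1: "integrable (exponential 1) (\<lambda>x. (ln x)\<^sup>2)"
proof (rule integrableI_bounded)
  have "(\<integral>\<^sup>+ x. ennreal ((ln x)\<^sup>2) \<partial>exponential 1)
      \<le> (\<integral>\<^sup>+ x. 16 * (ennreal (x powr (1/2)) + ennreal (x powr (-1/2))) \<partial>exponential 1)"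
  proof (intro nn_integral_mono_AE, use AE_exponential_pos[OF zero_less_one] in eventually_elim)
    case (elim x)
    then have "ennreal ((ln x)\<^sup>2) \<le> ennreal (16 * (x powr (1/2) + x powr (-1/2)))"
      by (intro ennreal_leI ln_squared_le_powr) simp
    then show ?case by (simp add: ennreal_mult)
  qed
  also have "\<dots> = 16 * (ennreal (Gamma (1/2 + 1)) + ennreal (Gamma (-1/2 + 1)))"
    by (simp add: nn_integral_cmult nn_integral_add nn_integral_powr_exponential)
  also have "\<dots> < \<infinity>"
    by (simp add: ennreal_mult_less_top)
  finally show "(\<integral>\<^sup>+ x. ennreal (norm ((ln x)\<^sup>2)) \<partial>exponential 1) < \<infinity>" by simp
qed simp

lemma integrable_ln_squared_exponential:
  assumes "0 < m"
  shows "integrable (exponential m) (\<lambda>x. (ln x)\<^sup>2)"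
proof -
  interpret prob_space "exponential 1" by (rule prob_space_exponential) simp
  have "integrable (exponential 1) (\<lambda>e. (ln (m * e))\<^sup>2)"
  proof (rule Bochner_Integration.integrable_bound)
    show "integrable (exponential 1) (\<lambda>e. 2 * (ln m)\<^sup>2 + 2 * (ln e)\<^sup>2)"
      by (simp add: integrable_ln_squared_exponential_1)
    show "AE e in exponential 1. norm ((ln (m * e))\<^sup>2) \<le> norm (2 * (ln m)\<^sup>2 + 2 * (ln e)\<^sup>2)"
      using AE_exponential_pos[OF zero_less_one]
    proof eventually_elim
      case (elim e)
      then have "ln (m * e) = ln m + ln e" using assms by (simp add: ln_mult)
      then show ?case using sum_squares_bound[of "ln m" "ln e"]
        by (simp add: power2_sum[symmetric]) (simp add: power2_sum)
    qed
  qed simp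
  then show ?thesis
    unfolding exponential_eq_distr[OF assms] by (subst integrable_distr_eq) auto
qed

lemma (in finite_measure) integrable_abs_add_const_squared:
  fixes f :: "'a \<Rightarrow> real"
  assumes "f \<in> borel_measurable M" and f: "integrable M (\<lambda>x. (f x)\<^sup>2)"
  shows "integrable M (\<lambda>x. (\<bar>f x\<bar> + c)\<^sup>2)"
  using square_integrable_imp_integrable[OF assms] f by (simp add: power2_sum)

lemma nn_integral_abs_ln_add_squared_finite:
  assumes "0 < m"
  shows "(\<integral>\<^sup>+ x. ennreal ((\<bar>ln x\<bar> + c)\<^sup>2) \<partial>exponential m) < \<infinity>"
proof -
  interpret prob_space "exponential m" by (rule prob_space_exponential[OF assms])
  have "integrable (exponential m) (\<lambda>x. (\<bar>ln x\<bar> + c)\<^sup>2)"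
    by (intro integrable_abs_add_const_squared integrable_ln_squared_exponential assms) measurable
  then show ?thesis by (simp add: integrable_iff_bounded)
qed

subsection \<open>Decision rules close to the logarithm\<close>

definition near_ln :: "real \<Rightarrow> (real \<Rightarrow> real) \<Rightarrow> bool" where
  "near_ln A d \<longleftrightarrow> d \<in> borel_measurable borel \<and> (\<forall>x>0. \<bar>d x - ln x\<bar> \<le> A)"

definition near_ln_bound :: "real \<Rightarrow> ennreal" where
  "near_ln_bound A = (\<integral>\<^sup>+ e. ennreal ((\<bar>ln e\<bar> + A)\<^sup>2) \<partial>exponential 1)"

definition clamp_rule :: "real \<Rightarrow> (real \<Rightarrow> real) \<Rightarrow> real \<Rightarrow> real" where
  "clamp_rule A d x = max (ln x - A) (min (ln x + A) (d x))"

definition ln_tail :: "real \<Rightarrow> ennreal" where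
  "ln_tail A = (\<integral>\<^sup>+ e. ennreal (if A < \<bar>ln e\<bar> then 4 * (ln e)\<^sup>2 else 0) \<partial>exponential 1)"

lemma near_ln_ln: "near_ln 0 ln"
  by (simp add: near_ln_def)

lemma near_ln_measurable: "near_ln A d \<Longrightarrow> d \<in> borel_measurable borel"
  by (simp add: near_ln_def)

lemma near_ln_clamp_rule:
  "d \<in> borel_measurable borel \<Longrightarrow> 0 \<le> A \<Longrightarrow> near_ln A (clamp_rule A d)"
  unfolding near_ln_def clamp_rule_def by (auto simp: max_def min_def)

lemma near_ln_bound_finite: "near_ln_bound A < \<infinity>"
  unfolding near_ln_bound_def by (rule nn_integral_abs_ln_add_squared_finite) simp

lemma scalar_risk_near_ln_le:
  assumes d: "near_ln A d" and "0 < m"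
  shows "scalar_risk d m \<le> near_ln_bound A"
  unfolding scalar_risk_eq_scaled[OF \<open>0 < m\<close> near_ln_measurable[OF d]] near_ln_bound_def
proof (intro nn_integral_mono_AE, use AE_exponential_pos[OF zero_less_one] in eventually_elim)
  case (elim e)
  have "ln (m * e) = ln m + ln e" using elim \<open>0 < m\<close> by (simp add: ln_mult)
  moreover have "\<bar>d (m * e) - ln (m * e)\<bar> \<le> A"
    using d elim \<open>0 < m\<close> by (simp add: near_ln_def)
  ultimately have "\<bar>d (m * e) - ln m\<bar> \<le> \<bar>\<bar>ln e\<bar> + A\<bar>" by linarith
  then show ?case by (simp add: ennreal_leI abs_le_square_iff)
qed

lemma clamp_rule_squared_error_le:
  assumes "0 \<le> A"
  shows "(clamp_rule A d x - t)\<^sup>2 \<le> (d x - t)\<^sup>2 + (if A < \<bar>ln x - t\<bar> then 4 * (ln x - t)\<^sup>2 else 0)"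
proof (cases "A < \<bar>ln x - t\<bar>")
  case True
  then have "\<bar>clamp_rule A d x - t\<bar> \<le> \<bar>2 * (ln x - t)\<bar>"
    using assms unfolding clamp_rule_def by (auto simp: max_def min_def abs_if)
  then have "(clamp_rule A d x - t)\<^sup>2 \<le> 4 * (ln x - t)\<^sup>2"
    unfolding abs_le_square_iff power_mult_distrib by simp
  then show ?thesis using True by (simp add: add_increasing)
next
  case False
  then have "\<bar>clamp_rule A d x - t\<bar> \<le> \<bar>d x - t\<bar>"
    using assms unfolding clamp_rule_def by (auto simp: max_def min_def abs_if)
  then show ?thesis using False by (simp add: abs_le_square_iff)
qed

lemma scalar_risk_clamp_rule_le:
  assumes "0 < m" "0 \<le> A" and d [measurable]: "d \<in> borel_measurable borel"
  shows "scalar_risk (clamp_rule A d) m \<le> scalar_risk d m + ln_tail A"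
proof -
  have "scalar_risk (clamp_rule A d) m =
      (\<integral>\<^sup>+ e. ennreal ((clamp_rule A d (m * e) - ln m)\<^sup>2) \<partial>exponential 1)"
    by (rule scalar_risk_eq_scaled[OF \<open>0 < m\<close> near_ln_measurable[OF near_ln_clamp_rule[OF d \<open>0 \<le> A\<close>]]])
  also have "\<dots> \<le> (\<integral>\<^sup>+ e. ennreal ((d (m * e) - ln m)\<^sup>2) +
      ennreal (if A < \<bar>ln e\<bar> then 4 * (ln e)\<^sup>2 else 0) \<partial>exponential 1)"
  proof (intro nn_integral_mono_AE, use AE_exponential_pos[OF zero_less_one] in eventually_elim)
    case (elim e)
    then have "ln (m * e) - ln m = ln e" using \<open>0 < m\<close> by (simp add: ln_mult)
    then have "(clamp_rule A d (m * e) - ln m)\<^sup>2 \<le>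
        (d (m * e) - ln m)\<^sup>2 + (if A < \<bar>ln e\<bar> then 4 * (ln e)\<^sup>2 else 0)"
      using clamp_rule_squared_error_le[OF \<open>0 \<le> A\<close>, of d "m * e" "ln m"] by (simp only:)
    then show ?case
      by (rule order_trans[OF ennreal_leI eq_refl[OF ennreal_plus]]) auto
  qed
  also have "\<dots> = scalar_risk d m + ln_tail A"
    unfolding ln_tail_def scalar_risk_eq_scaled[OF \<open>0 < m\<close> d] by (rule nn_integral_add) auto
  finally show ?thesis .
qed

lemma ln_tail_tendsto_0: "(\<lambda>k. ln_tail (real k)) \<longlonglongrightarrow> 0"
proof -
  have "(\<lambda>k. ln_tail (real k)) \<longlonglongrightarrow> (\<integral>\<^sup>+ e. 0 \<partial>exponential 1)"
    unfolding ln_tail_def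
  proof (rule nn_integral_dominated_convergence[where w="\<lambda>e. 4 * ennreal ((ln e)\<^sup>2)"])
    show "(\<integral>\<^sup>+ e. 4 * ennreal ((ln e)\<^sup>2) \<partial>exponential 1) < \<infinity>"
      using nn_integral_abs_ln_add_squared_finite[of 1 0]
      by (simp add: nn_integral_cmult ennreal_mult_less_top)
    show "AE e in exponential 1. (\<lambda>k. ennreal (if real k < \<bar>ln e\<bar> then 4 * (ln e)\<^sup>2 else 0)) \<longlonglongrightarrow> 0"
    proof (rule AE_I2, rule tendsto_eventually)
      fix e :: real
      show "\<forall>\<^sub>F k in sequentially. ennreal (if real k < \<bar>ln e\<bar> then 4 * (ln e)\<^sup>2 else 0) = 0"
        by (rule eventually_sequentiallyI[of "nat \<lceil>\<bar>ln e\<bar>\<rceil>"]) (simp add: nat_le_iff ceiling_le_iff)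
    qed
  qed (auto simp: ennreal_mult)
  then show ?thesis by simp
qed

lemma exponential_density_le_of_mean_le:
  assumes "1 \<le> m" "m \<le> M"
  shows "exponential_density (1 / m) x \<le> M * exponential_density (1 / M) x"
proof (cases "x < 0")
  case False
  then have "x / M \<le> x / m" using assms by (intro divide_left_mono) auto
  then have "1 / m * exp (- (x / m)) \<le> 1 * exp (- (x / M))"
    using assms by (intro mult_mono) auto
  then show ?thesis using False assms by (simp add: exponential_density_def)
qed (simp add: exponential_density_def)

lemma near_ln_squared_error_le:
  assumes d: "near_ln A d" and "0 < x" and m: "1 \<le> m" "m \<le> M"
  shows "(d x - ln m)\<^sup>2 \<le> (\<bar>ln x\<bar> + (A + ln M))\<^sup>2"
proof -
  have "\<bar>d x - ln x\<bar> \<le> A" using d \<open>0 < x\<close> by (simp add: near_ln_def)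
  moreover have "0 \<le> ln m" "ln m \<le> ln M" using m by auto
  ultimately have "\<bar>d x - ln m\<bar> \<le> \<bar>\<bar>ln x\<bar> + (A + ln M)\<bar>" by linarith
  then show ?thesis by (simp add: abs_le_square_iff)
qed

lemma AE_near_ln_integrand_le:
  assumes d: "near_ln A d" and m: "1 \<le> m" "m \<le> M"
  shows "AE x in lborel. ennreal (exponential_density (1 / m) x) * ennreal ((d x - ln m)\<^sup>2) \<le>
    ennreal M * (ennreal (exponential_density (1 / M) x) * ennreal ((\<bar>ln x\<bar> + (A + ln M))\<^sup>2))"
  using AE_lborel_singleton[of 0]
proof eventually_elim
  case (elim x)
  show ?case
  proof (cases "x < 0")
    case False
    then have "ennreal (exponential_density (1 / m) x) * ennreal ((d x - ln m)\<^sup>2) \<le>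
        ennreal (M * exponential_density (1 / M) x) * ennreal ((\<bar>ln x\<bar> + (A + ln M))\<^sup>2)"
      using elim m
      by (intro mult_mono ennreal_leI exponential_density_le_of_mean_le
          near_ln_squared_error_le[OF d]) auto
    then show ?thesis using m by (simp add: ennreal_mult' mult.assoc)
  qed (simp add: exponential_density_def)
qed

lemma tendsto_scalar_risk_near_ln:
  assumes d: "near_ln A d" and m: "\<And>k. 1 \<le> m k" "m \<longlonglongrightarrow> l"
  shows "(\<lambda>k. scalar_risk d (m k)) \<longlonglongrightarrow> scalar_risk d l"
proof -
  note [measurable] = near_ln_measurable[OF d]
  have "1 \<le> l" using m by (intro LIMSEQ_le_const[OF m(2)]) auto
  obtain M where M: "\<And>k. m k \<le> M"
    using convergent_imp_Bseq[OF convergentI[OF m(2)]] unfolding Bseq_def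
    by (metis abs_le_iff real_norm_def)
  have "1 \<le> M" using M[of 0] m(1)[of 0] by linarith
  let ?f = "\<lambda>m x. ennreal (exponential_density (1 / m) x) * ennreal ((d x - ln m)\<^sup>2)"
  let ?w = "\<lambda>x. ennreal M *
    (ennreal (exponential_density (1 / M) x) * ennreal ((\<bar>ln x\<bar> + (A + ln M))\<^sup>2))"
  have "(\<lambda>k. \<integral>\<^sup>+ x. ?f (m k) x \<partial>lborel) \<longlonglongrightarrow> (\<integral>\<^sup>+ x. ?f l x \<partial>lborel)"
  proof (rule nn_integral_dominated_convergence[where w="?w"])
    show "AE x in lborel. ?f (m k) x \<le> ?w x" for k
      by (rule AE_near_ln_integrand_le[OF d m(1) M])
    show "(\<integral>\<^sup>+ x. ?w x \<partial>lborel) < \<infinity>"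
      using nn_integral_abs_ln_add_squared_finite[of M "A + ln M"] \<open>1 \<le> M\<close>
      by (simp add: nn_integral_cmult nn_integral_exponential ennreal_mult_less_top)
    show "AE x in lborel. (\<lambda>k. ?f (m k) x) \<longlonglongrightarrow> ?f l x"
    proof (rule AE_I2)
      fix x :: real
      have "(\<lambda>k. exponential_density (1 / m k) x) \<longlonglongrightarrow> exponential_density (1 / l) x"
        unfolding exponential_density_def using m(2) \<open>1 \<le> l\<close>
        by (cases "x < 0") (auto intro!: tendsto_eq_intros)
      moreover have "(\<lambda>k. (d x - ln (m k))\<^sup>2) \<longlonglongrightarrow> (d x - ln l)\<^sup>2"
        using m(2) \<open>1 \<le> l\<close> by (auto intro!: tendsto_intros)
      ultimately show "(\<lambda>k. ?f (m k) x) \<longlonglongrightarrow> ?f l x"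
        by (intro tendsto_mult_ennreal tendsto_ennrealI) auto
    qed
  qed (simp_all add: exponential_density_def)
  then show ?thesis by (simp add: scalar_risk_eq_density)
qed

lemma scalar_risk_near_ln_finite:
  assumes "near_ln A d"
  shows "scalar_risk d (max 1 m) < \<infinity>"
  by (rule le_less_trans[OF scalar_risk_near_ln_le[OF assms] near_ln_bound_finite])
     (simp add: less_max_iff_disj)

lemma isCont_scalar_risk_near_ln:
  assumes d: "near_ln A d"
  shows "isCont (\<lambda>m. enn2real (scalar_risk d (max 1 m))) l"
proof (rule continuous_at_sequentiallyI)
  fix u assume "u \<longlonglongrightarrow> l"
  then have "(\<lambda>k. scalar_risk d (max 1 (u k))) \<longlonglongrightarrow> scalar_risk d (max 1 l)"
    by (intro tendsto_scalar_risk_near_ln[OF d] tendsto_intros) auto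
  then show "(\<lambda>k. enn2real (scalar_risk d (max 1 (u k)))) \<longlonglongrightarrow> enn2real (scalar_risk d (max 1 l))"
    using scalar_risk_near_ln_finite[OF d, of l] by (intro tendsto_enn2real) (simp_all add: less_top)
qed

subsection \<open>Priors and posterior means\<close>

locale mean_prior = real_distribution \<pi> for \<pi> :: "real measure" +
  assumes AE_ge_1: "AE m in \<pi>. 1 \<le> m"
begin

lemma AE_pos: "AE m in \<pi>. 0 < m"
  using AE_ge_1 by eventually_elim simp

lemma scalar_bayes_risk_near_ln_le:
  assumes "near_ln A d"
  shows "scalar_bayes_risk d \<pi> \<le> near_ln_bound A"
proof -
  have "scalar_bayes_risk d \<pi> \<le> (\<integral>\<^sup>+ m. near_ln_bound A \<partial>\<pi>)"
    unfolding scalar_bayes_risk_def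
    by (rule nn_integral_mono_AE, rule eventually_mono[OF AE_pos], rule scalar_risk_near_ln_le[OF assms])
  then show ?thesis using emeasure_space_1 by simp
qed

lemma scalar_bayes_risk_clamp_rule_le:
  assumes "0 \<le> A" and d [measurable]: "d \<in> borel_measurable borel"
  shows "scalar_bayes_risk (clamp_rule A d) \<pi> \<le> scalar_bayes_risk d \<pi> + ln_tail A"
proof -
  have "scalar_bayes_risk (clamp_rule A d) \<pi> \<le> (\<integral>\<^sup>+ m. scalar_risk d m + ln_tail A \<partial>\<pi>)"
    unfolding scalar_bayes_risk_def
    by (rule nn_integral_mono_AE, rule eventually_mono[OF AE_pos],
        rule scalar_risk_clamp_rule_le[OF _ assms])
  also have "\<dots> = scalar_bayes_risk d \<pi> + ln_tail A"
    unfolding scalar_bayes_risk_def using emeasure_space_1 by (subst nn_integral_add) auto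
  finally show ?thesis .
qed

lemma min_bayes_risk_finite: "min_bayes_risk \<pi> < \<infinity>"
  using min_bayes_risk_le[of ln \<pi>] scalar_bayes_risk_near_ln_le[OF near_ln_ln] near_ln_bound_finite[of 0]
  by (auto elim: order.trans intro: le_less_trans)

end

lemma mean_priorI:
  "prob_space \<pi> \<Longrightarrow> sets \<pi> = sets borel \<Longrightarrow> AE m in \<pi>. 1 \<le> m \<Longrightarrow> mean_prior \<pi>"
  by (simp add: mean_prior_def mean_prior_axioms_def real_distribution_def real_distribution_axioms_def)

lemma mean_prior_mix:
  assumes t: "t \<in> {0..1}" and "mean_prior \<pi>" "mean_prior \<rho>"
  shows "mean_prior (mix t \<pi> \<rho>)"
proof -
  interpret P: mean_prior \<pi> by fact
  interpret R: mean_prior \<rho> by fact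
  note branches = P.prob_space_axioms R.prob_space_axioms P.events_eq_borel R.events_eq_borel t
  show ?thesis
    by (rule mean_priorI[OF prob_space_mix[OF branches] sets_mix[OF branches]])
       (simp add: AE_mix[OF branches _ P.AE_ge_1 R.AE_ge_1])
qed

lemma mean_prior_return: "1 \<le> c \<Longrightarrow> mean_prior (return borel c)"
  by (rule mean_priorI) (simp_all add: prob_space_return AE_return)

lemma nn_integral_mix_prior:
  assumes "t \<in> {0..1}" "mean_prior \<pi>" "mean_prior \<rho>" "f \<in> borel_measurable borel"
  shows "(\<integral>\<^sup>+ m. f m \<partial>mix t \<pi> \<rho>) =
    ennreal t * (\<integral>\<^sup>+ m. f m \<partial>\<pi>) + ennreal (1 - t) * (\<integral>\<^sup>+ m. f m \<partial>\<rho>)"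
  using assms
  by (intro nn_integral_mix)
     (auto simp: mean_prior_def real_distribution_def real_distribution_axioms_def)

lemma scalar_bayes_risk_mix:
  assumes "t \<in> {0..1}" "mean_prior \<pi>" "mean_prior \<rho>" "d \<in> borel_measurable borel"
  shows "scalar_bayes_risk d (mix t \<pi> \<rho>) =
    ennreal t * scalar_bayes_risk d \<pi> + ennreal (1 - t) * scalar_bayes_risk d \<rho>"
  unfolding scalar_bayes_risk_def
  by (rule nn_integral_mix_prior[OF assms(1-3) measurable_scalar_risk[OF assms(4)]])

lemma min_bayes_risk_mix_ge:
  assumes "t \<in> {0..1}" "mean_prior \<pi>" "mean_prior \<rho>"
  shows "ennreal t * min_bayes_risk \<pi> + ennreal (1 - t) * min_bayes_risk \<rho> \<le> min_bayes_risk (mix t \<pi> \<rho>)"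
  unfolding min_bayes_risk_def[of "mix t \<pi> \<rho>"]
  by (rule INF_greatest)
     (auto simp: scalar_bayes_risk_mix[OF assms] intro!: add_mono mult_left_mono min_bayes_risk_le)

definition likelihood :: "real \<Rightarrow> real \<Rightarrow> real" where
  "likelihood x m = exp (- (x / m)) / m"

definition posterior_mean :: "real measure \<Rightarrow> real \<Rightarrow> real" where
  "posterior_mean \<pi> x = weighted_mean \<pi> (likelihood x) ln"

lemma exponential_density_eq_likelihood:
  "ennreal (exponential_density (1 / m) x) = indicator {0..} x * ennreal (likelihood x m)"
  by (auto simp: exponential_density_def likelihood_def split: split_indicator)

lemma measurable_likelihood [measurable]: "likelihood x \<in> borel_measurable borel"
  unfolding likelihood_def by measurable

lemma likelihood_pos: "1 \<le> m \<Longrightarrow> 0 < likelihood x m"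
  by (simp add: likelihood_def)

lemma likelihood_le:
  assumes "1 \<le> m"
  shows "likelihood x m \<le> exp \<bar>x\<bar> / m"
proof -
  have "(- x) / m \<le> \<bar>x\<bar> / m" using assms by (intro divide_right_mono) auto
  also have "\<dots> \<le> \<bar>x\<bar> / 1" using assms by (intro divide_left_mono) auto
  finally have "- (x / m) \<le> \<bar>x\<bar>" by simp
  then show ?thesis unfolding likelihood_def using assms by (intro divide_right_mono) auto
qed

lemma ln_power_le_linear:
  fixes m :: real
  assumes "1 \<le> m" "j \<le> 2"
  shows "(ln m) ^ j \<le> 4 * m"
proof -
  consider "j = 0" | "j = 1" | "j = 2" using assms(2) by linarith
  then show ?thesis
  proof cases
    case 2
    then show ?thesis using ln_le_minus_one[of m] assms(1) by simp
  next
    case 3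
    have "ln m = 2 * ln (sqrt m)" using assms(1) by (simp add: ln_sqrt)
    also have "\<dots> \<le> 2 * sqrt m" using ln_le_minus_one[of "sqrt m"] assms(1) by simp
    finally have "(ln m)\<^sup>2 \<le> (2 * sqrt m)\<^sup>2" using assms(1) by (intro power_mono) auto
    then show ?thesis using 3 assms(1) by (simp add: power_mult_distrib)
  qed (use assms(1) in simp)
qed

context mean_prior
begin

lemma AE_likelihood_pos: "AE m in \<pi>. 0 < likelihood x m"
  using AE_ge_1 by eventually_elim (rule likelihood_pos)

lemma integrable_ln_power_likelihood:
  assumes "j \<le> 2"
  shows "integrable \<pi> (\<lambda>m. (ln m) ^ j * likelihood x m)"
proof (rule integrable_const_bound[where B="4 * exp \<bar>x\<bar>"])
  show "AE m in \<pi>. norm ((ln m) ^ j * likelihood x m) \<le> 4 * exp \<bar>x\<bar>"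
    using AE_ge_1
  proof eventually_elim
    case (elim m)
    then have "(ln m) ^ j * likelihood x m \<le> 4 * m * (exp \<bar>x\<bar> / m)"
      by (intro mult_mono ln_power_le_linear likelihood_le assms)
         (auto intro: less_imp_le likelihood_pos)
    then show ?case using elim likelihood_pos[OF elim, of x] by simp
  qed
qed measurable

lemmas integrable_likelihood =
  integrable_ln_power_likelihood[of 0, simplified]
  integrable_ln_power_likelihood[of 1, simplified]
  integrable_ln_power_likelihood[of 2, simplified]

lemma integral_likelihood_pos: "0 < (LINT m|\<pi>. likelihood x m)"
proof -
  have nonneg: "AE m in \<pi>. 0 \<le> likelihood x m"
    using AE_likelihood_pos[of x] by eventually_elim simp
  have "(LINT m|\<pi>. likelihood x m) \<noteq> 0"
  proof
    assume "(LINT m|\<pi>. likelihood x m) = 0"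
    then have "AE m in \<pi>. likelihood x m = 0"
      using integral_nonneg_eq_0_iff_AE[OF integrable_likelihood(1) nonneg] by simp
    with AE_likelihood_pos[of x] have "AE m in \<pi>. False" by eventually_elim simp
    then show False by simp
  qed
  with integral_nonneg_AE[OF nonneg] show ?thesis by simp
qed

lemma measurable_posterior_mean: "posterior_mean \<pi> \<in> borel_measurable borel"
  unfolding posterior_mean_def[abs_def] weighted_mean_def likelihood_def
  by (intro borel_measurable_divide borel_measurable_lebesgue_integral) simp_all

lemma scalar_bayes_risk_eq_posterior:
  assumes [measurable]: "d \<in> borel_measurable borel"
  shows "scalar_bayes_risk d \<pi> = (\<integral>\<^sup>+ x. indicator {0..} x *
      (\<integral>\<^sup>+ m. ennreal (likelihood x m) * ennreal ((d x - ln m)\<^sup>2) \<partial>\<pi>) \<partial>lborel)"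
proof -
  interpret pair_sigma_finite \<pi> lborel ..
  have "scalar_bayes_risk d \<pi> =
      (\<integral>\<^sup>+ m. \<integral>\<^sup>+ x. indicator {0..} x * ennreal (likelihood x m) * ennreal ((d x - ln m)\<^sup>2) \<partial>lborel \<partial>\<pi>)"
    unfolding scalar_bayes_risk_def scalar_risk_eq_density[OF assms] exponential_density_eq_likelihood ..
  also have "\<dots> =
      (\<integral>\<^sup>+ x. \<integral>\<^sup>+ m. indicator {0..} x * ennreal (likelihood x m) * ennreal ((d x - ln m)\<^sup>2) \<partial>\<pi> \<partial>lborel)"
    by (intro Fubini'[symmetric]) (unfold likelihood_def, measurable)
  finally show ?thesis
    by (simp add: mult.assoc nn_integral_cmult)
qed

theorem min_bayes_risk_eq_posterior_mean:
  "min_bayes_risk \<pi> = scalar_bayes_risk (posterior_mean \<pi>) \<pi>"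
proof (rule antisym)
  have "AE m in \<pi>. 0 \<le> likelihood x m" for x
    using AE_likelihood_pos[of x] by eventually_elim simp
  then have "(\<integral>\<^sup>+ m. ennreal (likelihood x m) * ennreal ((posterior_mean \<pi> x - ln m)\<^sup>2) \<partial>\<pi>)
      \<le> (\<integral>\<^sup>+ m. ennreal (likelihood x m) * ennreal ((a - ln m)\<^sup>2) \<partial>\<pi>)" for x a
    unfolding posterior_mean_def
    by (rule weighted_mean_minimizes[OF _ integral_likelihood_pos integrable_likelihood])
  then show "scalar_bayes_risk (posterior_mean \<pi>) \<pi> \<le> min_bayes_risk \<pi>"
    unfolding min_bayes_risk_def
    by (intro INF_greatest)
       (simp add: scalar_bayes_risk_eq_posterior measurable_posterior_mean
          nn_integral_mono mult_left_mono)
qed (rule min_bayes_risk_le[OF measurable_posterior_mean])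

lemma scalar_bayes_risk_le_liminf:
  assumes [measurable]: "\<And>k. d k \<in> borel_measurable borel"
    and lim: "\<And>x. (\<lambda>k. d k x) \<longlonglongrightarrow> d' x"
  shows "scalar_bayes_risk d' \<pi> \<le> liminf (\<lambda>k. scalar_bayes_risk (d k) \<pi>)"
proof -
  have "scalar_risk d' m \<le> liminf (\<lambda>k. scalar_risk (d k) m)" for m
  proof -
    have "scalar_risk d' m = (\<integral>\<^sup>+ x. liminf (\<lambda>k. ennreal ((d k x - ln m)\<^sup>2)) \<partial>exponential m)"
      unfolding scalar_risk_def
      by (intro nn_integral_cong lim_imp_Liminf[symmetric] tendsto_ennrealI tendsto_intros lim) simp
    also have "\<dots> \<le> liminf (\<lambda>k. scalar_risk (d k) m)"
      unfolding scalar_risk_def by (rule nn_integral_liminf) simp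
    finally show ?thesis .
  qed
  then have "scalar_bayes_risk d' \<pi> \<le> (\<integral>\<^sup>+ m. liminf (\<lambda>k. scalar_risk (d k) m) \<partial>\<pi>)"
    unfolding scalar_bayes_risk_def by (intro nn_integral_mono)
  also have "\<dots> \<le> liminf (\<lambda>k. scalar_bayes_risk (d k) \<pi>)"
    unfolding scalar_bayes_risk_def by (rule nn_integral_liminf) simp
  finally show ?thesis .
qed

end

lemma posterior_mean_mix_tendsto:
  assumes "mean_prior \<pi>" "mean_prior \<rho>" and t: "\<And>k. t k \<in> {0..1}" "t \<longlonglongrightarrow> 0"
  shows "(\<lambda>k. posterior_mean (mix (t k) \<rho> \<pi>) x) \<longlonglongrightarrow> posterior_mean \<pi> x"
proof -
  interpret P: mean_prior \<pi> by fact
  interpret R: mean_prior \<rho> by fact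
  have integral_mix_likelihood: "(LINT m|mix (t k) \<rho> \<pi>. (ln m) ^ j * likelihood x m) =
      t k * (LINT m|\<rho>. (ln m) ^ j * likelihood x m) +
      (1 - t k) * (LINT m|\<pi>. (ln m) ^ j * likelihood x m)"
    if "j \<le> 2" for j k
  proof (rule integral_mix[OF R.prob_space_axioms P.prob_space_axioms
        R.events_eq_borel P.events_eq_borel t(1)])
    have "0 \<le> (ln m) ^ j * likelihood x m" if "1 \<le> m" for m
      using that by (simp add: likelihood_pos less_imp_le)
    then show "AE m in \<rho>. 0 \<le> (ln m) ^ j * likelihood x m" "AE m in \<pi>. 0 \<le> (ln m) ^ j * likelihood x m"
      using R.AE_ge_1 P.AE_ge_1 by (auto elim: eventually_mono)
  qed (simp_all add: that R.integrable_ln_power_likelihood P.integrable_ln_power_likelihood)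
  let ?N = "\<lambda>\<pi>. LINT m|\<pi>. ln m * likelihood x m" and ?D = "\<lambda>\<pi>. LINT m|\<pi>. likelihood x m"
  have "(\<lambda>k. (t k * ?N \<rho> + (1 - t k) * ?N \<pi>) / (t k * ?D \<rho> + (1 - t k) * ?D \<pi>))
      \<longlonglongrightarrow> (0 * ?N \<rho> + (1 - 0) * ?N \<pi>) / (0 * ?D \<rho> + (1 - 0) * ?D \<pi>)"
    using P.integral_likelihood_pos[of x] by (intro tendsto_intros t(2)) auto
  then show ?thesis
    using integral_mix_likelihood[of 0] integral_mix_likelihood[of 1]
    by (simp add: posterior_mean_def weighted_mean_def)
qed

subsection \<open>Least favourable priors\<close>

definition least_favourable :: "real measure set \<Rightarrow> real measure \<Rightarrow> bool" where
  "least_favourable C \<pi> \<longleftrightarrow> \<pi> \<in> C \<and> (\<forall>\<rho>\<in>C. min_bayes_risk \<rho> \<le> min_bayes_risk \<pi>)"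

lemma least_favourable_mem: "least_favourable C \<pi> \<Longrightarrow> \<pi> \<in> C"
  by (simp add: least_favourable_def)

lemma least_favourable_ge: "least_favourable C \<pi> \<Longrightarrow> \<rho> \<in> C \<Longrightarrow> min_bayes_risk \<rho> \<le> min_bayes_risk \<pi>"
  by (simp add: least_favourable_def)

lemma posterior_mean_mix_risk_le:
  assumes \<pi>: "mean_prior \<pi>" and \<rho>: "mean_prior \<rho>" and t: "0 < t" "t \<le> 1"
    and mix_le: "min_bayes_risk (mix t \<rho> \<pi>) \<le> min_bayes_risk \<pi>"
  shows "scalar_bayes_risk (posterior_mean (mix t \<rho> \<pi>)) \<rho> \<le> min_bayes_risk \<pi>"
proof -
  have t01: "t \<in> {0..1}" using t by simp
  interpret M: mean_prior "mix t \<rho> \<pi>" by (rule mean_prior_mix[OF t01 \<rho> \<pi>])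
  let ?d = "posterior_mean (mix t \<rho> \<pi>)" and ?b = "min_bayes_risk \<pi>"
  have "ennreal t * scalar_bayes_risk ?d \<rho> + ennreal (1 - t) * ?b
      \<le> ennreal t * scalar_bayes_risk ?d \<rho> + ennreal (1 - t) * scalar_bayes_risk ?d \<pi>"
    by (intro add_left_mono mult_left_mono min_bayes_risk_le M.measurable_posterior_mean) simp
  also have "\<dots> = min_bayes_risk (mix t \<rho> \<pi>)"
    by (simp add: scalar_bayes_risk_mix[OF t01 \<rho> \<pi>]
        M.measurable_posterior_mean M.min_bayes_risk_eq_posterior_mean)
  also have "\<dots> \<le> ennreal t * ?b + ennreal (1 - t) * ?b"
    using mix_le t by (simp add: distrib_right[symmetric] ennreal_plus[symmetric] del: ennreal_plus)
  finally have "ennreal t * scalar_bayes_risk ?d \<rho> \<le> ennreal t * ?b"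
    unfolding add.commute[of _ "ennreal (1 - t) * ?b"] ennreal_add_left_cancel_le
    using mean_prior.min_bayes_risk_finite[OF \<pi>] by (auto simp: ennreal_mult_eq_top_iff)
  then show ?thesis using t by (simp add: ennreal_mult_le_mult_iff)
qed

theorem least_favourable_posterior_mean_risk_le:
  assumes priors: "\<And>\<sigma>. \<sigma> \<in> C \<Longrightarrow> mean_prior \<sigma>"
    and convex: "\<And>t \<sigma> \<tau>. t \<in> {0..1} \<Longrightarrow> \<sigma> \<in> C \<Longrightarrow> \<tau> \<in> C \<Longrightarrow> mix t \<sigma> \<tau> \<in> C"
    and lf: "least_favourable C \<pi>" and \<rho>: "\<rho> \<in> C"
  shows "scalar_bayes_risk (posterior_mean \<pi>) \<rho> \<le> min_bayes_risk \<pi>"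
proof -
  note \<pi> = least_favourable_mem[OF lf]
  define t where "t k = inverse (real (Suc k))" for k
  have t: "0 < t k" "t k \<le> 1" for k by (auto simp: t_def field_simps)
  have t01: "t k \<in> {0..1}" for k using t[of k] by simp
  have mixture: "mix (t k) \<rho> \<pi> \<in> C" for k by (rule convex[OF t01 \<rho> \<pi>])
  let ?d = "\<lambda>k. posterior_mean (mix (t k) \<rho> \<pi>)"
  have "scalar_bayes_risk (posterior_mean \<pi>) \<rho> \<le> liminf (\<lambda>k. scalar_bayes_risk (?d k) \<rho>)"
  proof (rule mean_prior.scalar_bayes_risk_le_liminf[OF priors[OF \<rho>]])
    show "?d k \<in> borel_measurable borel" for k
      by (rule mean_prior.measurable_posterior_mean[OF priors[OF mixture]])
    have "t \<longlonglongrightarrow> 0" unfolding t_def by (rule LIMSEQ_inverse_real_of_nat)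
    then show "(\<lambda>k. ?d k x) \<longlonglongrightarrow> posterior_mean \<pi> x" for x
      by (rule posterior_mean_mix_tendsto[OF priors[OF \<pi>] priors[OF \<rho>] t01])
  qed
  also have "\<dots> \<le> limsup (\<lambda>k. scalar_bayes_risk (?d k) \<rho>)"
    by (rule Liminf_le_Limsup) simp
  also have "\<dots> \<le> min_bayes_risk \<pi>"
  proof (intro Limsup_bounded always_eventually allI)
    show "scalar_bayes_risk (?d k) \<rho> \<le> min_bayes_risk \<pi>" for k
      by (intro posterior_mean_mix_risk_le priors \<pi> \<rho> t least_favourable_ge[OF lf mixture])
  qed
  finally show ?thesis .
qed

lemma weak_conv_scalar_bayes_risk_near_ln:
  assumes \<pi>: "\<And>k. mean_prior (\<pi> k)" and M: "mean_prior M" and conv: "weak_conv_m \<pi> M"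
    and d: "near_ln A d"
  shows "(\<lambda>k. scalar_bayes_risk d (\<pi> k)) \<longlonglongrightarrow> scalar_bayes_risk d M"
proof -
  let ?r = "\<lambda>m. enn2real (scalar_risk d (max 1 m))"
  have "scalar_bayes_risk d \<rho> = (\<integral>\<^sup>+ m. ennreal (?r m) \<partial>\<rho>)" if "mean_prior \<rho>" for \<rho>
    unfolding scalar_bayes_risk_def
  proof (rule nn_integral_cong_AE, use mean_prior.AE_ge_1[OF that] in eventually_elim)
    case (elim m)
    then show ?case using scalar_risk_near_ln_finite[OF d, of m] by (simp add: max_absorb2)
  qed
  moreover have "(\<lambda>k. \<integral>\<^sup>+ m. ennreal (?r m) \<partial>\<pi> k) \<longlonglongrightarrow> (\<integral>\<^sup>+ m. ennreal (?r m) \<partial>M)"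
  proof (rule weak_conv_imp_nn_integral_bdd_continuous_conv)
    show "?r m \<le> enn2real (near_ln_bound A)" for m
      using near_ln_bound_finite[of A] scalar_risk_near_ln_le[OF d, of "max 1 m"]
      by (intro enn2real_mono) (simp_all add: less_max_iff_disj less_top)
  qed (use \<pi> M conv isCont_scalar_risk_near_ln[OF d] in \<open>simp_all add: mean_prior.axioms(1)\<close>)
  ultimately show ?thesis using \<pi> M by simp
qed

lemma min_bayes_risk_weak_limit_ge:
  assumes \<pi>: "\<And>k. mean_prior (\<pi> k)" and M: "mean_prior M" and conv: "weak_conv_m \<pi> M"
    and lim: "(\<lambda>k. min_bayes_risk (\<pi> k)) \<longlonglongrightarrow> b"
  shows "b \<le> min_bayes_risk M"
  unfolding min_bayes_risk_def[of M]
proof (rule INF_greatest)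
  fix d :: "real \<Rightarrow> real" assume d: "d \<in> borel_measurable borel"
  have clamped: "b \<le> scalar_bayes_risk d M + ln_tail (real j)" for j
  proof -
    let ?d = "clamp_rule (real j) d"
    have near: "near_ln (real j) ?d" by (rule near_ln_clamp_rule[OF d]) simp
    have "b \<le> scalar_bayes_risk ?d M"
      by (rule LIMSEQ_le[OF lim weak_conv_scalar_bayes_risk_near_ln[OF \<pi> M conv near]])
         (auto intro!: min_bayes_risk_le near_ln_measurable[OF near])
    also have "\<dots> \<le> scalar_bayes_risk d M + ln_tail (real j)"
      by (rule mean_prior.scalar_bayes_risk_clamp_rule_le[OF M _ d]) simp
    finally show ?thesis .
  qed
  have "(\<lambda>j. scalar_bayes_risk d M + ln_tail (real j)) \<longlonglongrightarrow> scalar_bayes_risk d M + 0"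
    by (intro tendsto_add tendsto_const ln_tail_tendsto_0)
  then show "b \<le> scalar_bayes_risk d M"
    using clamped by (intro LIMSEQ_le_const[of _ "scalar_bayes_risk d M"]) auto
qed

theorem least_favourable_exists:
  assumes "C \<noteq> {}" and priors: "\<And>\<pi>. \<pi> \<in> C \<Longrightarrow> mean_prior \<pi>"
    and compact: "\<And>\<pi> :: nat \<Rightarrow> real measure. (\<And>k. \<pi> k \<in> C) \<Longrightarrow>
      \<exists>r M. strict_mono (r :: nat \<Rightarrow> nat) \<and> M \<in> C \<and> weak_conv_m (\<pi> \<circ> r) M"
  obtains \<pi> where "least_favourable C \<pi>"
proof -
  obtain v where v: "incseq v" "range v \<subseteq> min_bayes_risk ` C"
    "(SUP \<pi>\<in>C. min_bayes_risk \<pi>) = (SUP k. v k)"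
    using ennreal_Sup_countable_SUP[of "min_bayes_risk ` C"] \<open>C \<noteq> {}\<close>
    unfolding image_is_empty by meson
  have "\<exists>\<pi>. \<pi> \<in> C \<and> v k = min_bayes_risk \<pi>" for k
    using v(2) by (auto simp: image_subset_iff image_iff)
  then obtain \<pi> where \<pi>: "\<And>k. \<pi> k \<in> C" "\<And>k. v k = min_bayes_risk (\<pi> k)" by metis
  obtain r M where r: "strict_mono r" and M: "M \<in> C" and conv: "weak_conv_m (\<pi> \<circ> r) M"
    using compact[of \<pi>, OF \<pi>(1)] by blast
  have "v \<longlonglongrightarrow> (SUP \<pi>\<in>C. min_bayes_risk \<pi>)"
    unfolding v(3) by (rule LIMSEQ_SUP[OF v(1)])
  from LIMSEQ_subseq_LIMSEQ[OF this r]
  have lim: "(\<lambda>k. min_bayes_risk ((\<pi> \<circ> r) k)) \<longlonglongrightarrow> (SUP \<pi>\<in>C. min_bayes_risk \<pi>)"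
    unfolding comp_def \<pi>(2) .
  have "(SUP \<pi>\<in>C. min_bayes_risk \<pi>) \<le> min_bayes_risk M"
    by (rule min_bayes_risk_weak_limit_ge[OF _ priors[OF M] conv lim]) (simp add: priors \<pi>(1))
  then have "min_bayes_risk \<rho> \<le> min_bayes_risk M" if "\<rho> \<in> C" for \<rho>
    using SUP_upper[OF that] by (rule order_trans[rotated])
  with M have "least_favourable C M" by (simp add: least_favourable_def)
  then show ?thesis by (rule that)
qed

subsection \<open>Priors with a moment constraint\<close>

definition moment_priors :: "real \<Rightarrow> real \<Rightarrow> real measure set" where
  "moment_priors p \<eta> = {\<pi>. mean_prior \<pi> \<and> (\<integral>\<^sup>+ m. ennreal (ln m powr p) \<partial>\<pi>) \<le> ennreal (\<eta> powr p)}"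

lemma mean_prior_moment_priors: "\<pi> \<in> moment_priors p \<eta> \<Longrightarrow> mean_prior \<pi>"
  by (simp add: moment_priors_def)

lemma return_in_moment_priors: "1 \<le> c \<Longrightarrow> ln c powr p \<le> \<eta> powr p \<Longrightarrow> return borel c \<in> moment_priors p \<eta>"
  by (simp add: moment_priors_def mean_prior_return nn_integral_return ennreal_leI)

lemma moment_priors_convex:
  assumes t: "t \<in> {0..1}" and \<pi>: "\<pi> \<in> moment_priors p \<eta>" and \<rho>: "\<rho> \<in> moment_priors p \<eta>"
  shows "mix t \<pi> \<rho> \<in> moment_priors p \<eta>"
proof -
  note mean_priors = mean_prior_moment_priors[OF \<pi>] mean_prior_moment_priors[OF \<rho>]
  have "(\<integral>\<^sup>+ m. ennreal (ln m powr p) \<partial>mix t \<pi> \<rho>) =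
      ennreal t * (\<integral>\<^sup>+ m. ennreal (ln m powr p) \<partial>\<pi>) +
      ennreal (1 - t) * (\<integral>\<^sup>+ m. ennreal (ln m powr p) \<partial>\<rho>)"
    by (rule nn_integral_mix_prior[OF t mean_priors]) simp
  also have "\<dots> \<le> ennreal t * ennreal (\<eta> powr p) + ennreal (1 - t) * ennreal (\<eta> powr p)"
    using \<pi> \<rho> by (intro add_mono mult_left_mono) (auto simp: moment_priors_def)
  also have "\<dots> = ennreal (\<eta> powr p)"
    using t by (simp add: distrib_right[symmetric] ennreal_plus[symmetric] del: ennreal_plus)
  finally show ?thesis
    by (simp add: moment_priors_def mean_prior_mix[OF t mean_priors])
qed

lemma moment_priors_tail_le:
  assumes \<pi>: "\<pi> \<in> moment_priors p \<eta>" and "0 < p" "0 < s"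
  shows "measure \<pi> {exp s<..} \<le> \<eta> powr p * s powr - p"
proof -
  interpret mean_prior \<pi> by (rule mean_prior_moment_priors[OF \<pi>])
  have "ennreal (s powr p) * emeasure \<pi> {exp s<..} =
      (\<integral>\<^sup>+ m. ennreal (s powr p) * indicator {exp s<..} m \<partial>\<pi>)"
    by (rule nn_integral_cmult_indicator[symmetric]) simp
  also have "\<dots> \<le> (\<integral>\<^sup>+ m. ennreal (ln m powr p) \<partial>\<pi>)"
  proof (rule nn_integral_mono)
    fix m
    have "s \<le> ln m" if "exp s < m"
      using that less_trans[OF exp_gt_zero that] by (simp add: ln_ge_iff)
    then show "ennreal (s powr p) * indicator {exp s<..} m \<le> ennreal (ln m powr p)"
      using assms by (auto split: split_indicator intro!: ennreal_leI powr_mono2)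
  qed
  also have "\<dots> \<le> ennreal (\<eta> powr p)" using \<pi> by (simp add: moment_priors_def)
  finally have "s powr p * measure \<pi> {exp s<..} \<le> \<eta> powr p"
    by (simp add: emeasure_eq_measure ennreal_mult[symmetric])
  then show ?thesis using \<open>0 < s\<close> by (simp add: powr_minus field_simps)
qed

lemma tight_moment_priors:
  assumes \<pi>: "\<And>k. \<pi> k \<in> moment_priors p \<eta>" and "0 < p"
  shows "tight \<pi>"
  unfolding tight_def
proof (intro conjI allI impI)
  interpret mean_prior "\<pi> k" for k by (rule mean_prior_moment_priors[OF \<pi>])
  show "real_distribution (\<pi> k)" for k by unfold_locales
  fix \<epsilon> :: real assume "0 < \<epsilon>"
  have "((\<lambda>s. \<eta> powr p * s powr - p) \<longlongrightarrow> \<eta> powr p * 0) at_top"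
    using \<open>0 < p\<close> by (intro tendsto_mult tendsto_const tendsto_neg_powr filterlim_ident) simp
  then have "\<forall>\<^sub>F s in at_top. \<eta> powr p * s powr - p < \<epsilon> \<and> 0 < s"
    using \<open>0 < \<epsilon>\<close> by (intro eventually_conj order_tendstoD(2) eventually_gt_at_top) auto
  then obtain s where s: "\<eta> powr p * s powr - p < \<epsilon>" "0 < s"
    by (auto simp: eventually_at_top_linorder)
  have "1 - \<epsilon> < measure (\<pi> k) {0<..exp s}" for k
  proof -
    have "1 - \<epsilon> < 1 - measure (\<pi> k) {exp s<..}"
      using moment_priors_tail_le[OF \<pi> \<open>0 < p\<close> s(2), of k] s(1) by simp
    also have "\<dots> = measure (\<pi> k) (UNIV - {exp s<..})"
      using prob_compl[of "{exp s<..}" k] by simp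
    also have "\<dots> = measure (\<pi> k) {0<..exp s}"
      using AE_pos[of k] by (intro finite_measure_eq_AE) (auto elim!: eventually_mono)
    finally show ?thesis .
  qed
  then show "\<exists>a b. a < b \<and> (\<forall>k. 1 - \<epsilon> < measure (\<pi> k) {a<..b})"
    using exp_gt_zero[of s] by blast
qed

lemma moment_priors_weakly_closed:
  assumes \<pi>: "\<And>k. \<pi> k \<in> moment_priors p \<eta>" and "0 < p"
    and M: "real_distribution M" and conv: "weak_conv_m \<pi> M"
  shows "M \<in> moment_priors p \<eta>"
proof -
  interpret M: real_distribution M by (rule M)
  have AE_\<pi>: "AE m in \<pi> k. 1 \<le> m" for k
    using mean_prior.AE_ge_1[OF mean_prior_moment_priors[OF \<pi>]] .
  have distr: "real_distribution (\<pi> k)" for k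
    using mean_prior.axioms(1)[OF mean_prior_moment_priors[OF \<pi>]] .
  have AE_M: "AE m in M. 1 \<le> m"
    by (rule weak_conv_AE_ge[OF distr M conv AE_\<pi>])
  have "(\<integral>\<^sup>+ m. ennreal (ln m powr p) \<partial>M) = (\<integral>\<^sup>+ m. ennreal (ln (max 1 m) powr p) \<partial>M)"
    using AE_M by (intro nn_integral_cong_AE) (auto elim!: eventually_mono simp: max_absorb2)
  also have "\<dots> \<le> ennreal (\<eta> powr p)"
  proof (rule weak_conv_nn_integral_le[OF distr M conv])
    have "continuous_on UNIV (\<lambda>m::real. ln (max 1 m) powr p)"
      using \<open>0 < p\<close> by (intro continuous_intros continuous_on_powr') auto
    then show "isCont (\<lambda>m. ln (max 1 m) powr p) x" for x :: real
      by (simp add: continuous_on_eq_continuous_at)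
    have "(\<integral>\<^sup>+ m. ennreal (ln (max 1 m) powr p) \<partial>\<pi> k) = (\<integral>\<^sup>+ m. ennreal (ln m powr p) \<partial>\<pi> k)" for k
      using AE_\<pi>[of k] by (intro nn_integral_cong_AE) (auto elim!: eventually_mono simp: max_absorb2)
    then show "(\<integral>\<^sup>+ m. ennreal (ln (max 1 m) powr p) \<partial>\<pi> k) \<le> ennreal (\<eta> powr p)" for k
      using \<pi>[of k] by (simp add: moment_priors_def)
  qed simp
  finally show ?thesis
    by (simp add: moment_priors_def mean_priorI M.prob_space_axioms AE_M)
qed

lemma least_favourable_moment_priors_exists:
  assumes "0 < p"
  obtains \<pi> where "least_favourable (moment_priors p \<eta>) \<pi>"
proof (rule least_favourable_exists)
  have "return borel 1 \<in> moment_priors p \<eta>" by (simp add: return_in_moment_priors)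
  then show "moment_priors p \<eta> \<noteq> {}" by blast
  fix \<pi> :: "nat \<Rightarrow> real measure" assume \<pi>: "\<And>k. \<pi> k \<in> moment_priors p \<eta>"
  obtain r M where "strict_mono r" "real_distribution M" "weak_conv_m (\<pi> \<circ> r) M"
    using tight_imp_convergent_subsubsequence[OF tight_moment_priors[of \<pi>, OF \<pi> assms] strict_mono_id]
    by auto
  moreover from this have "M \<in> moment_priors p \<eta>"
    using moment_priors_weakly_closed[of "\<pi> \<circ> r"] \<pi> assms by simp
  ultimately show "\<exists>r M. strict_mono r \<and> M \<in> moment_priors p \<eta> \<and> weak_conv_m (\<pi> \<circ> r) M" by blast
qed (auto intro: that mean_prior_moment_priors)

lemma min_bayes_risk_two_point_pos:
  assumes bc: "1 \<le> b" "1 \<le> c" "b \<noteq> c" and t: "0 < t" "t < 1"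
  shows "0 < min_bayes_risk (mix t (return borel b) (return borel c))"
proof (rule ccontr)
  let ?\<pi> = "mix t (return borel b) (return borel c)"
  have t01: "t \<in> {0..1}" using t by simp
  note points = mean_prior_return[OF bc(1)] mean_prior_return[OF bc(2)]
  interpret mean_prior ?\<pi> by (rule mean_prior_mix[OF t01 points])
  define d where "d = posterior_mean ?\<pi>"
  have d [measurable]: "d \<in> borel_measurable borel"
    unfolding d_def by (rule measurable_posterior_mean)
  assume "\<not> 0 < min_bayes_risk ?\<pi>"
  then have "scalar_bayes_risk d ?\<pi> = 0"
    by (simp add: min_bayes_risk_eq_posterior_mean d_def)
  then have "scalar_bayes_risk d (return borel b) = 0" "scalar_bayes_risk d (return borel c) = 0"
    using t by (simp_all add: scalar_bayes_risk_mix[OF t01 points d])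
  then have "scalar_risk d b = 0" "scalar_risk d c = 0"
    by (simp_all add: scalar_bayes_risk_def nn_integral_return)
  then have "AE x in exponential 1. d x = ln b" "AE x in exponential 1. d x = ln c"
    using bc by (simp_all add: scalar_risk_eq_0_iff AE_exponential_iff)
  then have "AE x in exponential 1. ln b = ln c" by eventually_elim simp
  moreover have "prob_space (exponential 1)" by (rule prob_space_exponential) simp
  ultimately show False
    using bc by (simp add: prob_space.AE_const)
qed

lemma least_favourable_moment_priors_pos:
  assumes "0 < \<eta>" and lf: "least_favourable (moment_priors p \<eta>) \<pi>"
  shows "0 < min_bayes_risk \<pi>"
proof -
  let ?\<rho> = "mix (1/2) (return borel (exp \<eta>)) (return borel 1)"
  have "0 < min_bayes_risk ?\<rho>"
    using \<open>0 < \<eta>\<close> by (intro min_bayes_risk_two_point_pos) auto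
  also have "\<dots> \<le> min_bayes_risk \<pi>"
    using \<open>0 < \<eta>\<close> by (intro least_favourable_ge[OF lf] moment_priors_convex return_in_moment_priors) auto
  finally show ?thesis .
qed

subsection \<open>The risk as an average over the coordinates\<close>

text \<open>
  Writing the observations as \<open>\<mu>\<^sub>i e\<^sub>i\<close> with standard exponential \<open>e\<^sub>i\<close> makes the sampling measure
  independent of the parameter, so that Fubini applies to parameter and noise jointly.
\<close>

definition scale_coords :: "nat \<Rightarrow> (nat \<Rightarrow> real) \<Rightarrow> (nat \<Rightarrow> real) \<Rightarrow> (nat \<Rightarrow> real)" where
  "scale_coords n \<mu> e = (\<lambda>i\<in>{..<n}. \<mu> i * e i)"

abbreviation vectors :: "nat \<Rightarrow> (nat \<Rightarrow> real) measure" where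
  "vectors n \<equiv> PiM {..<n} (\<lambda>_. borel)"

abbreviation noise :: "nat \<Rightarrow> (nat \<Rightarrow> real) measure" where
  "noise n \<equiv> PiM {..<n} (\<lambda>_. exponential 1)"

definition coord_loss ::
  "nat \<Rightarrow> ((nat \<Rightarrow> real) \<Rightarrow> (nat \<Rightarrow> real)) \<Rightarrow> nat \<Rightarrow> (nat \<Rightarrow> real) \<Rightarrow> (nat \<Rightarrow> real) \<Rightarrow> real" where
  "coord_loss n est i \<mu> e = (ln (est (scale_coords n \<mu> e) i) - ln (\<mu> i))\<^sup>2"

definition coord_risk :: "nat \<Rightarrow> ((nat \<Rightarrow> real) \<Rightarrow> (nat \<Rightarrow> real)) \<Rightarrow> nat \<Rightarrow> (nat \<Rightarrow> real) \<Rightarrow> ennreal" where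
  "coord_risk n est i \<mu> = (\<integral>\<^sup>+ e. ennreal (coord_loss n est i \<mu> e) \<partial>noise n)"

lemma measurable_vector_component:
  "sets P = sets (vectors n) \<Longrightarrow> (\<lambda>\<mu>. \<mu> i) \<in> borel_measurable P"
  by (rule measurable_PiM_borel_component[OF measurable_ident_sets])

lemma measurable_ln_powr_component:
  assumes "sets P = sets (vectors n)"
  shows "(\<lambda>\<mu>. ln (\<mu> i) powr p) \<in> borel_measurable P"
  by (rule measurable_compose[OF measurable_vector_component[OF assms]]) simp

lemma sets_PiM_exponential [measurable_cong]:
  "sets (PiM I (\<lambda>i. exponential (\<mu> i))) = sets (PiM I (\<lambda>_. borel))"
  by (rule sets_PiM_cong) auto

lemma prob_space_noise: "prob_space (PiM I (\<lambda>_. exponential 1))"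
  by (rule prob_space_PiM) (simp add: prob_space_exponential)

lemma obs_model_eq_PiM: "obs_model n \<mu> = PiM {..<n} (\<lambda>i. exponential (\<mu> i))"
  by (simp add: obs_model_def exponential_def)

lemma measurable_scale_coords:
  assumes "f \<in> measurable M (vectors n)" "g \<in> measurable M (vectors n)"
  shows "(\<lambda>z. scale_coords n (f z) (g z)) \<in> measurable M (vectors n)"
  unfolding scale_coords_def
  by (rule measurable_restrict) (intro borel_measurable_times assms[THEN measurable_PiM_borel_component])

lemma scale_coords_restrict: "scale_coords n (restrict \<mu> {..<n}) = scale_coords n \<mu>"
  by (auto simp: scale_coords_def fun_eq_iff)

lemma obs_model_eq_distr:
  assumes "\<And>i. i < n \<Longrightarrow> 0 < \<mu> i"
  shows "obs_model n \<mu> = distr (noise n) (vectors n) (scale_coords n \<mu>)"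
proof -
  have "distr (noise n) (vectors n) (scale_coords n \<mu>) =
      PiM {..<n} (\<lambda>i. distr (exponential 1) borel (\<lambda>e. \<mu> i * e))"
    unfolding scale_coords_def[abs_def]
    by (rule distr_PiM_componentwise) (simp_all add: prob_space_exponential)
  also have "\<dots> = obs_model n \<mu>"
    unfolding obs_model_eq_PiM using assms by (intro PiM_cong refl exponential_eq_distr[symmetric]) simp
  finally show ?thesis ..
qed

lemma estimators_iff:
  "est \<in> estimators n \<longleftrightarrow> (\<forall>i<n. (\<lambda>x. est x i) \<in> borel_measurable (vectors n)) \<and> (\<forall>x. \<forall>i<n. 0 < est x i)"
proof -
  have "sets (PiM {..<n} (\<lambda>_. lborel :: real measure)) = sets (vectors n)"
    by (rule sets_PiM_cong) auto
  from measurable_cong_sets[OF this refl]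
  have "borel_measurable (PiM {..<n} (\<lambda>_. lborel :: real measure)) =
      (borel_measurable (vectors n) :: ((nat \<Rightarrow> real) \<Rightarrow> real) set)" .
  then show ?thesis by (simp add: estimators_def)
qed

lemma measurable_coord_loss:
  assumes "est \<in> estimators n" "i < n"
    and u: "u \<in> measurable M (vectors n)" and v: "v \<in> measurable M (vectors n)"
  shows "(\<lambda>z. coord_loss n est i (u z) (v z)) \<in> borel_measurable M"
proof -
  have [measurable]: "(\<lambda>z. est (scale_coords n (u z) (v z)) i) \<in> borel_measurable M"
    by (rule measurable_compose[OF measurable_scale_coords[OF u v], of "\<lambda>x. est x i"])
       (use assms in \<open>simp add: estimators_iff\<close>)
  have [measurable]: "(\<lambda>z. u z i) \<in> borel_measurable M"
    by (rule measurable_PiM_borel_component[OF u])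
  show ?thesis unfolding coord_loss_def by measurable
qed

lemma measurable_coord_risk:
  assumes "est \<in> estimators n" "i < n"
  shows "coord_risk n est i \<in> borel_measurable (vectors n)"
proof -
  interpret prob_space "noise n" by (rule prob_space_noise)
  have "(\<lambda>z. coord_loss n est i (fst z) (snd z)) \<in> borel_measurable (vectors n \<Otimes>\<^sub>M noise n)"
    by (rule measurable_coord_loss[OF assms]) measurable
  then show ?thesis
    unfolding coord_risk_def[abs_def]
    by (intro borel_measurable_nn_integral) (simp add: case_prod_beta')
qed

lemma coord_risk_restrict: "i < n \<Longrightarrow> coord_risk n est i (restrict \<mu> {..<n}) = coord_risk n est i \<mu>"
  by (simp add: coord_risk_def coord_loss_def scale_coords_restrict)

lemma log_loss_scale_coords:
  "log_loss n (est (scale_coords n \<mu> e)) \<mu> = (1 / real n) * (\<Sum>i<n. coord_loss n est i \<mu> e)"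
  by (simp add: log_loss_def coord_loss_def)

theorem risk_eq_average:
  assumes n: "0 < n" and est: "est \<in> estimators n" and \<mu>: "\<And>i. i < n \<Longrightarrow> 0 < \<mu> i"
  shows "risk n est \<mu> = (\<Sum>i<n. coord_risk n est i \<mu>) / ennreal (real n)"
proof -
  define \<nu> where "\<nu> = restrict \<mu> {..<n}"
  have \<nu>: "\<nu> \<in> space (vectors n)" by (simp add: \<nu>_def space_PiM)
  have measurable_\<nu>: "(\<lambda>_. \<nu>) \<in> measurable M (vectors n)" for M :: "(nat \<Rightarrow> real) measure"
    by (rule measurable_const[OF \<nu>])
  have measurable_noise: "(\<lambda>e. e) \<in> measurable (noise n) (vectors n)" by measurable
  have obs_model: "obs_model n \<mu> = distr (noise n) (vectors n) (scale_coords n \<nu>)"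
    by (simp add: \<nu>_def scale_coords_restrict obs_model_eq_distr \<mu>)
  have "(\<lambda>x. est x i) \<in> borel_measurable (vectors n)" if "i < n" for i
    using est that by (simp add: estimators_iff)
  then have "(\<lambda>x. ennreal (log_loss n (est x) \<mu>)) \<in> borel_measurable (vectors n)"
    unfolding log_loss_def
    by (intro measurable_compose[OF _ measurable_ennreal] borel_measurable_times borel_measurable_const
        borel_measurable_sum borel_measurable_power borel_measurable_diff borel_measurable_ln) auto
  then have "risk n est \<mu> = (\<integral>\<^sup>+ e. ennreal (log_loss n (est (scale_coords n \<nu> e)) \<mu>) \<partial>noise n)"
    unfolding risk_def obs_model
    by (subst nn_integral_distr[OF measurable_scale_coords[OF measurable_\<nu> measurable_noise]]) simp_all
  also have "\<dots> = (\<integral>\<^sup>+ e. ennreal ((1 / real n) * (\<Sum>i<n. coord_loss n est i \<nu> e)) \<partial>noise n)"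
    unfolding \<nu>_def log_loss_scale_coords[symmetric] by (simp add: log_loss_def)
  also have "\<dots> = (\<Sum>i<n. coord_risk n est i \<nu>) / ennreal (real n)"
    unfolding coord_risk_def
    by (rule nn_integral_mean[OF n _ measurable_coord_loss[OF est _ measurable_\<nu> measurable_noise]])
       (simp_all add: coord_loss_def)
  also have "\<dots> = (\<Sum>i<n. coord_risk n est i \<mu>) / ennreal (real n)"
    by (simp add: \<nu>_def coord_risk_restrict)
  finally show ?thesis .
qed

theorem bayes_risk_eq_average:
  assumes n: "0 < n" and est: "est \<in> estimators n" and sets: "sets P = sets (vectors n)"
    and pos: "AE \<mu> in P. \<forall>i<n. 0 < \<mu> i"
  shows "bayes_risk n est P = (\<Sum>i<n. \<integral>\<^sup>+ \<mu>. coord_risk n est i \<mu> \<partial>P) / ennreal (real n)"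
proof -
  have [measurable]: "coord_risk n est i \<in> borel_measurable P" if "i \<in> {..<n}" for i
    using measurable_coord_risk[OF est, of i] that by (simp add: sets cong: measurable_cong_sets)
  have "bayes_risk n est P = (\<integral>\<^sup>+ \<mu>. (\<Sum>i<n. coord_risk n est i \<mu>) / ennreal (real n) \<partial>P)"
    unfolding bayes_risk_def
    by (rule nn_integral_cong_AE) (use pos in \<open>eventually_elim, auto intro: risk_eq_average[OF n est]\<close>)
  also have "\<dots> = (\<Sum>i<n. \<integral>\<^sup>+ \<mu>. coord_risk n est i \<mu> \<partial>P) / ennreal (real n)"
    by (subst nn_integral_divide, measurable) (simp add: nn_integral_sum)
  finally show ?thesis .
qed

subsection \<open>The minimax risk is at most the minimax-Bayes risk\<close>

lemma AE_return_vectors_iff: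
  assumes "Measurable.pred borel Q"
  shows "(AE \<nu> in return (vectors n) (restrict \<mu> {..<n}). \<forall>i<n. Q (\<nu> i)) \<longleftrightarrow> (\<forall>i<n. Q (\<mu> i))"
proof -
  have "Measurable.pred (vectors n) (\<lambda>\<nu>. Q (\<nu> i))" for i
    by (rule measurable_compose[OF measurable_vector_component[OF refl] assms])
  then have "Measurable.pred (vectors n) (\<lambda>\<nu>. \<forall>i\<in>{..<n}. Q (\<nu> i))"
    by (intro pred_intros_finite(3)) simp_all
  moreover have "restrict \<mu> {..<n} \<in> space (vectors n)" by (simp add: space_PiM)
  ultimately have "(AE \<nu> in return (vectors n) (restrict \<mu> {..<n}). \<forall>i\<in>{..<n}. Q (\<nu> i)) \<longleftrightarrow>
      (\<forall>i\<in>{..<n}. Q (restrict \<mu> {..<n} i))"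
    by (intro AE_return)
  then show ?thesis by (simp add: Ball_def)
qed

lemma bayes_risk_return:
  assumes n: "0 < n" and est: "est \<in> estimators n" and \<mu>: "\<And>i. i < n \<Longrightarrow> 0 < \<mu> i"
  shows "bayes_risk n est (return (vectors n) (restrict \<mu> {..<n})) = risk n est \<mu>"
proof -
  let ?\<delta> = "return (vectors n) (restrict \<mu> {..<n})"
  have "AE \<nu> in ?\<delta>. \<forall>i<n. 0 < \<nu> i"
    using \<mu> by (subst AE_return_vectors_iff) auto
  then have "bayes_risk n est ?\<delta> = (\<Sum>i<n. \<integral>\<^sup>+ \<nu>. coord_risk n est i \<nu> \<partial>?\<delta>) / ennreal (real n)"
    by (intro bayes_risk_eq_average n est) simp_all
  also have "\<dots> = risk n est \<mu>"
    by (simp add: nn_integral_return measurable_coord_risk est space_PiM coord_risk_restrict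
        risk_eq_average n \<mu>)
  finally show ?thesis .
qed

lemma return_in_priors:
  assumes "\<mu> \<in> Mset n p \<eta>"
  shows "return (vectors n) (restrict \<mu> {..<n}) \<in> priors n p \<eta>"
proof -
  have "restrict \<mu> {..<n} \<in> space (vectors n)" by (simp add: space_PiM)
  then have "(\<integral>\<^sup>+ \<nu>. ennreal ((1 / real n) * (\<Sum>i<n. ln (\<nu> i) powr p))
        \<partial>return (vectors n) (restrict \<mu> {..<n})) =
      ennreal ((1 / real n) * (\<Sum>i<n. ln (\<mu> i) powr p))"
    by (subst nn_integral_return) (simp_all add: measurable_ln_powr_component)
  then show ?thesis
    using assms unfolding priors_def Mset_def
    by (simp add: prob_space_return space_PiM AE_return_vectors_iff ennreal_leI)
qed

theorem minimax_risk_le_minimax_bayes_risk: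
  assumes "0 < n"
  shows "minimax_risk n p \<eta> \<le> minimax_bayes_risk n p \<eta>"
  unfolding minimax_risk_def minimax_bayes_risk_def
proof (intro INF_mono bexI SUP_least)
  fix est \<mu> assume est: "est \<in> estimators n" and \<mu>: "\<mu> \<in> Mset n p \<eta>"
  have "0 < \<mu> i" if "i < n" for i
    using \<mu> that by (force simp: Mset_def intro: less_le_trans[OF zero_less_one])
  then have "risk n est \<mu> = bayes_risk n est (return (vectors n) (restrict \<mu> {..<n}))"
    by (rule bayes_risk_return[OF assms est, symmetric])
  also have "\<dots> \<le> (SUP \<pi>\<in>priors n p \<eta>. bayes_risk n est \<pi>)"
    by (intro SUP_upper return_in_priors \<mu>)
  finally show "risk n est \<mu> \<le> (SUP \<pi>\<in>priors n p \<eta>. bayes_risk n est \<pi>)" .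
qed

subsection \<open>Upper bound for the minimax-Bayes risk\<close>

definition separable_estimator :: "(real \<Rightarrow> real) \<Rightarrow> (nat \<Rightarrow> real) \<Rightarrow> nat \<Rightarrow> real" where
  "separable_estimator d x i = exp (d (x i))"

definition average_marginal :: "nat \<Rightarrow> (nat \<Rightarrow> real) measure \<Rightarrow> real measure" where
  "average_marginal n P = mixture (pmf_of_set {..<n}) (\<lambda>i. distr P borel (\<lambda>\<mu>. \<mu> i))"

lemma separable_estimator_in_estimators:
  assumes d: "d \<in> borel_measurable borel"
  shows "separable_estimator d \<in> estimators n"
proof -
  have "(\<lambda>x. d (x i)) \<in> borel_measurable (vectors n)" for i
    by (rule measurable_compose[OF measurable_vector_component[OF refl] d])
  then show ?thesis by (simp add: estimators_iff separable_estimator_def)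
qed

lemma coord_risk_separable_estimator:
  assumes "i < n" "0 < \<mu> i" and [measurable]: "d \<in> borel_measurable borel"
  shows "coord_risk n (separable_estimator d) i \<mu> = scalar_risk d (\<mu> i)"
proof -
  have "coord_risk n (separable_estimator d) i \<mu> =
      (\<integral>\<^sup>+ e. ennreal ((d (\<mu> i * e i) - ln (\<mu> i))\<^sup>2) \<partial>noise n)"
    using \<open>i < n\<close> by (simp add: coord_risk_def coord_loss_def separable_estimator_def scale_coords_def)
  also have "\<dots> = (\<integral>\<^sup>+ e. ennreal ((d (\<mu> i * e) - ln (\<mu> i))\<^sup>2) \<partial>exponential 1)"
    using \<open>i < n\<close>
    by (intro nn_integral_PiM_component[where M="\<lambda>_. exponential 1"])
       (auto simp: prob_space_exponential)
  finally show ?thesis by (simp add: scalar_risk_eq_scaled assms)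
qed

context
  fixes n :: nat and P :: "(nat \<Rightarrow> real) measure"
  assumes P: "prob_space P" "sets P = sets (vectors n)"
begin

lemma marginals: "prob_space (distr P borel (\<lambda>\<mu>. \<mu> i))" "sets (distr P borel (\<lambda>\<mu>. \<mu> i)) = sets borel"
  by (simp_all add: prob_space.prob_space_distr[OF P(1) measurable_vector_component[OF P(2)]])

lemma nn_integral_average_marginal:
  assumes n: "0 < n" and f: "f \<in> borel_measurable borel"
  shows "(\<integral>\<^sup>+ m. f m \<partial>average_marginal n P) = (\<Sum>i<n. \<integral>\<^sup>+ \<mu>. f (\<mu> i) \<partial>P) / ennreal (real n)"
proof -
  have "(\<integral>\<^sup>+ m. f m \<partial>average_marginal n P) =
      (\<Sum>i<n. \<integral>\<^sup>+ m. f m \<partial>distr P borel (\<lambda>\<mu>. \<mu> i)) / ennreal (real n)"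
    unfolding average_marginal_def using n
    by (simp add: nn_integral_mixture[OF marginals f] nn_integral_pmf_of_set
        lessThan_empty_iff ennreal_of_nat_eq_real_of_nat)
  then show ?thesis by (simp add: nn_integral_distr measurable_vector_component[OF P(2)] f)
qed

lemma mean_prior_average_marginal:
  assumes n: "0 < n" and ge_1: "AE \<mu> in P. \<forall>i<n. 1 \<le> \<mu> i"
  shows "mean_prior (average_marginal n P)"
proof -
  have "AE m in average_marginal n P. 1 \<le> m"
    unfolding average_marginal_def using n ge_1
    by (subst AE_mixture_iff[OF marginals])
       (auto simp: set_pmf_of_set lessThan_empty_iff AE_distr_iff
          measurable_vector_component[OF P(2)] elim!: eventually_mono)
  then show ?thesis
    unfolding average_marginal_def
    by (intro mean_priorI prob_space_mixture[OF marginals] sets_mixture[OF marginals])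
qed

lemma bayes_risk_separable_estimator:
  assumes n: "0 < n" and d: "d \<in> borel_measurable borel" and pos: "AE \<mu> in P. \<forall>i<n. 0 < \<mu> i"
  shows "bayes_risk n (separable_estimator d) P = scalar_bayes_risk d (average_marginal n P)"
proof -
  have "(\<integral>\<^sup>+ \<mu>. coord_risk n (separable_estimator d) i \<mu> \<partial>P) =
      (\<integral>\<^sup>+ \<mu>. scalar_risk d (\<mu> i) \<partial>P)" if "i < n" for i
    using that pos
    by (intro nn_integral_cong_AE)
       (auto elim!: eventually_mono intro: coord_risk_separable_estimator d)
  then show ?thesis
    by (simp add: bayes_risk_eq_average n separable_estimator_in_estimators d P(2) pos
        scalar_bayes_risk_def nn_integral_average_marginal measurable_scalar_risk)
qed

end

lemma average_marginal_in_moment_priors: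
  assumes n: "0 < n" and P: "P \<in> priors n p \<eta>"
  shows "average_marginal n P \<in> moment_priors p \<eta>"
proof -
  have prior: "prob_space P" "sets P = sets (vectors n)" "AE \<mu> in P. \<forall>i<n. 1 \<le> \<mu> i"
    and moment: "(\<integral>\<^sup>+ \<mu>. ennreal ((1 / real n) * (\<Sum>i<n. ln (\<mu> i) powr p)) \<partial>P) \<le> ennreal (\<eta> powr p)"
    using P by (auto simp: priors_def)
  have "(\<integral>\<^sup>+ m. ennreal (ln m powr p) \<partial>average_marginal n P) =
      (\<Sum>i<n. \<integral>\<^sup>+ \<mu>. ennreal (ln (\<mu> i) powr p) \<partial>P) / ennreal (real n)"
    by (rule nn_integral_average_marginal[OF prior(1,2) n]) simp
  also have "\<dots> = (\<integral>\<^sup>+ \<mu>. ennreal ((1 / real n) * (\<Sum>i<n. ln (\<mu> i) powr p)) \<partial>P)"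
    by (rule nn_integral_mean[OF n _ measurable_ln_powr_component[OF prior(2)], symmetric]) simp
  finally show ?thesis
    using moment mean_prior_average_marginal[OF prior(1,2) n prior(3)] by (simp add: moment_priors_def)
qed

theorem minimax_bayes_risk_le_least_favourable:
  assumes n: "0 < n" and lf: "least_favourable (moment_priors p \<eta>) \<pi>"
  shows "minimax_bayes_risk n p \<eta> \<le> min_bayes_risk \<pi>"
proof -
  have d: "posterior_mean \<pi> \<in> borel_measurable borel"
    using mean_prior_moment_priors[OF least_favourable_mem[OF lf]]
    by (rule mean_prior.measurable_posterior_mean)
  have "minimax_bayes_risk n p \<eta> \<le>
      (SUP P\<in>priors n p \<eta>. bayes_risk n (separable_estimator (posterior_mean \<pi>)) P)"
    unfolding minimax_bayes_risk_def by (intro INF_lower separable_estimator_in_estimators d)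
  also have "\<dots> \<le> min_bayes_risk \<pi>"
  proof (rule SUP_least)
    fix P assume P: "P \<in> priors n p \<eta>"
    then have "AE \<mu> in P. \<forall>i<n. 0 < \<mu> i"
      by (auto simp: priors_def elim!: eventually_mono intro: less_le_trans[OF zero_less_one])
    then have "bayes_risk n (separable_estimator (posterior_mean \<pi>)) P =
        scalar_bayes_risk (posterior_mean \<pi>) (average_marginal n P)"
      using P by (intro bayes_risk_separable_estimator n d) (auto simp: priors_def)
    also have "\<dots> \<le> min_bayes_risk \<pi>"
      by (rule least_favourable_posterior_mean_risk_le[OF mean_prior_moment_priors
            moment_priors_convex lf average_marginal_in_moment_priors[OF n P]])
    finally show "bayes_risk n (separable_estimator (posterior_mean \<pi>)) P \<le> min_bayes_risk \<pi>" .
  qed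
  finally show ?thesis .
qed

subsection \<open>Product priors\<close>

text \<open>
  With all coordinates but one frozen, an estimator of that coordinate is a rule for the scalar problem.
\<close>

lemma min_bayes_risk_le_frozen_coord_loss:
  assumes \<pi>: "mean_prior \<pi>" and est: "est \<in> estimators n" and i: "i < n"
  shows "min_bayes_risk \<pi> \<le>
    (\<integral>\<^sup>+ m. \<integral>\<^sup>+ e. ennreal (coord_loss n est i (y(i := m)) (z(i := e))) \<partial>exponential 1 \<partial>\<pi>)"
proof -
  interpret mean_prior \<pi> by (rule \<pi>)
  define J where "J = {..<n} - {i}"
  have J: "{..<n} = J \<union> {i}" "i \<notin> J" using i by (auto simp: J_def)
  define frozen where "frozen = (\<lambda>j\<in>J. y j * z j)"
  define d where "d x = ln (est (frozen(i := x)) i)" for x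
  have "(\<lambda>x. frozen(i := x)) \<in> measurable borel (vectors n)"
    by (rule measurable_fun_upd[OF J(1)]) (simp_all add: frozen_def space_PiM)
  then have "(\<lambda>x. est (frozen(i := x)) i) \<in> borel_measurable borel"
    by (rule measurable_compose) (use est i in \<open>simp add: estimators_iff\<close>)
  then have d: "d \<in> borel_measurable borel"
    unfolding d_def by simp
  have scale_upd: "scale_coords n (y(i := m)) (z(i := e)) = frozen(i := m * e)" for m e
    using J by (auto simp: scale_coords_def frozen_def fun_eq_iff)
  have "min_bayes_risk \<pi> \<le> scalar_bayes_risk d \<pi>"
    by (rule min_bayes_risk_le[OF d])
  also have "\<dots> = (\<integral>\<^sup>+ m. \<integral>\<^sup>+ e. ennreal (coord_loss n est i (y(i := m)) (z(i := e))) \<partial>exponential 1 \<partial>\<pi>)"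
    unfolding scalar_bayes_risk_def
  proof (rule nn_integral_cong_AE, use AE_pos in eventually_elim)
    case (elim m)
    then show ?case by (simp add: scalar_risk_eq_scaled d coord_loss_def scale_upd d_def)
  qed
  finally show ?thesis .
qed

lemma min_bayes_risk_le_coord_risk:
  assumes \<pi>: "mean_prior \<pi>" and est: "est \<in> estimators n" and i: "i < n"
  shows "min_bayes_risk \<pi> \<le> (\<integral>\<^sup>+ \<mu>. coord_risk n est i \<mu> \<partial>PiM {..<n} (\<lambda>_. \<pi>))"
proof -
  interpret mean_prior \<pi> by (rule \<pi>)
  define J where "J = {..<n} - {i}"
  have J: "finite J" "i \<notin> J" "{..<n} = insert i J" using i by (auto simp: J_def)
  interpret PJ: prob_space "PiM J (\<lambda>_. \<pi>)" by (rule prob_space_PiM) (rule prob_space_axioms)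
  interpret EJ: prob_space "PiM J (\<lambda>_. exponential 1)" by (rule prob_space_noise)
  have [measurable_cong]: "sets (PiM {..<n} (\<lambda>_. \<pi>)) = sets (vectors n)"
    by (rule sets_PiM_cong) auto
  have measurable_loss: "(\<lambda>(\<mu>, e). ennreal (coord_loss n est i \<mu> e)) \<in>
      borel_measurable (PiM {..<n} (\<lambda>_. \<pi>) \<Otimes>\<^sub>M noise n)"
    unfolding case_prod_beta'
    by (intro measurable_compose[OF measurable_coord_loss[OF est i] measurable_ennreal]) measurable
  have "min_bayes_risk \<pi> = (\<integral>\<^sup>+ y. \<integral>\<^sup>+ z. min_bayes_risk \<pi> \<partial>PiM J (\<lambda>_. exponential 1) \<partial>PiM J (\<lambda>_. \<pi>))"
    by (simp add: PJ.emeasure_space_1 EJ.emeasure_space_1)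
  also have "\<dots> \<le> (\<integral>\<^sup>+ y. \<integral>\<^sup>+ z. \<integral>\<^sup>+ m. \<integral>\<^sup>+ e. ennreal (coord_loss n est i (y(i := m)) (z(i := e)))
      \<partial>exponential 1 \<partial>\<pi> \<partial>PiM J (\<lambda>_. exponential 1) \<partial>PiM J (\<lambda>_. \<pi>))"
    by (intro nn_integral_mono min_bayes_risk_le_frozen_coord_loss \<pi> est i)
  also have "\<dots> = (\<integral>\<^sup>+ \<mu>. coord_risk n est i \<mu> \<partial>PiM {..<n} (\<lambda>_. \<pi>))"
    unfolding coord_risk_def J(3)
    by (rule nn_integral_PiM_insert_pair[symmetric, OF _ _ J(1,2)])
       (use measurable_loss J(3) in \<open>simp_all add: prob_space_axioms prob_space_exponential\<close>)
  finally show ?thesis .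
qed

theorem min_bayes_risk_le_bayes_risk_iid:
  assumes \<pi>: "mean_prior \<pi>" and est: "est \<in> estimators n" and n: "0 < n"
  shows "min_bayes_risk \<pi> \<le> bayes_risk n est (PiM {..<n} (\<lambda>_. \<pi>))"
proof -
  interpret mean_prior \<pi> by (rule \<pi>)
  have "min_bayes_risk \<pi> = (\<Sum>i<n. min_bayes_risk \<pi>) / ennreal (real n)"
    using n by (simp add: ennreal_of_nat_eq_real_of_nat mult.commute ennreal_mult_divide_eq)
  also have "\<dots> \<le> (\<Sum>i<n. \<integral>\<^sup>+ \<mu>. coord_risk n est i \<mu> \<partial>PiM {..<n} (\<lambda>_. \<pi>)) / ennreal (real n)"
    by (intro divide_right_mono_ennreal sum_mono min_bayes_risk_le_coord_risk \<pi> est) simp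
  also have "\<dots> = bayes_risk n est (PiM {..<n} (\<lambda>_. \<pi>))"
  proof (rule bayes_risk_eq_average[symmetric, OF n est])
    show "sets (PiM {..<n} (\<lambda>_. \<pi>)) = sets (vectors n)"
      by (rule sets_PiM_cong) auto
    show "AE \<mu> in PiM {..<n} (\<lambda>_. \<pi>). \<forall>i<n. 0 < \<mu> i"
      using AE_PiM_finite[of "{..<n}" "\<lambda>_. \<pi>" "\<lambda>_ m. 0 < m"]
      by (simp add: prob_space_axioms AE_pos Ball_def)
  qed
  finally show ?thesis .
qed

subsection \<open>Bayes lower bounds for the minimax risk\<close>

definition clamp_estimator :: "real \<Rightarrow> ((nat \<Rightarrow> real) \<Rightarrow> (nat \<Rightarrow> real)) \<Rightarrow> (nat \<Rightarrow> real) \<Rightarrow> (nat \<Rightarrow> real)" where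
  "clamp_estimator T est x i = max 1 (min T (est x i))"

lemma clamp_estimator_in_estimators:
  "est \<in> estimators n \<Longrightarrow> clamp_estimator T est \<in> estimators n"
  by (auto simp: estimators_iff clamp_estimator_def less_max_iff_disj)

lemma ln_clamp_error_le:
  fixes a m T :: real
  assumes m: "1 \<le> m" "m \<le> T" and a: "0 < a"
  shows "(ln (max 1 (min T a)) - ln m)\<^sup>2 \<le> (ln a - ln m)\<^sup>2"
    and "(ln (max 1 (min T a)) - ln m)\<^sup>2 \<le> (ln T)\<^sup>2"
proof -
  have ln_clamp: "ln (max 1 (min T a)) = max 0 (min (ln T) (ln a))"
    using assms by (auto simp: max_def min_def)
  have "0 \<le> ln m" "ln m \<le> ln T" using m by auto
  then have "\<bar>ln (max 1 (min T a)) - ln m\<bar> \<le> \<bar>ln a - ln m\<bar>" "\<bar>ln (max 1 (min T a)) - ln m\<bar> \<le> \<bar>ln T\<bar>"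
    unfolding ln_clamp by (auto simp: max_def min_def abs_if)
  then show "(ln (max 1 (min T a)) - ln m)\<^sup>2 \<le> (ln a - ln m)\<^sup>2"
    "(ln (max 1 (min T a)) - ln m)\<^sup>2 \<le> (ln T)\<^sup>2"
    by (simp_all only: abs_le_square_iff)
qed

lemma risk_clamp_estimator_le:
  assumes "est \<in> estimators n" and \<mu>: "\<And>i. i < n \<Longrightarrow> 1 \<le> \<mu> i \<and> \<mu> i \<le> T"
  shows "risk n (clamp_estimator T est) \<mu> \<le> risk n est \<mu>"
proof -
  have "log_loss n (clamp_estimator T est x) \<mu> \<le> log_loss n (est x) \<mu>" for x
    unfolding log_loss_def clamp_estimator_def
    by (intro mult_left_mono sum_mono ln_clamp_error_le) (use assms in \<open>auto simp: estimators_iff\<close>)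
  then show ?thesis
    unfolding risk_def by (intro nn_integral_mono ennreal_leI)
qed

lemma risk_clamp_estimator_le_ln_squared:
  assumes est: "est \<in> estimators n" and \<mu>: "\<And>i. i < n \<Longrightarrow> 1 \<le> \<mu> i \<and> \<mu> i \<le> T"
  shows "risk n (clamp_estimator T est) \<mu> \<le> ennreal ((ln T)\<^sup>2)"
proof -
  have "log_loss n (clamp_estimator T est x) \<mu> \<le> (ln T)\<^sup>2" for x
  proof -
    have "(\<Sum>i<n. (ln (clamp_estimator T est x i) - ln (\<mu> i))\<^sup>2) \<le> (\<Sum>i<n. (ln T)\<^sup>2)"
      unfolding clamp_estimator_def
      by (intro sum_mono ln_clamp_error_le) (use assms in \<open>auto simp: estimators_iff\<close>)
    then show ?thesis by (cases "n = 0") (simp_all add: log_loss_def field_simps)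
  qed
  then have "risk n (clamp_estimator T est) \<mu> \<le> (\<integral>\<^sup>+ x. ennreal ((ln T)\<^sup>2) \<partial>obs_model n \<mu>)"
    unfolding risk_def by (intro nn_integral_mono ennreal_leI)
  moreover have "prob_space (obs_model n \<mu>)"
    unfolding obs_model_def
    by (intro prob_space_PiM prob_space_exponential_density)
       (use \<mu> in \<open>force intro: less_le_trans[OF zero_less_one]\<close>)
  ultimately show ?thesis by (simp add: prob_space.emeasure_space_1)
qed

lemma sets_not_Mset:
  assumes sets: "sets P = sets (vectors n)"
  shows "{\<mu> \<in> space P. \<mu> \<notin> Mset n p \<eta>} \<in> sets P"
proof -
  have "{\<mu> \<in> space P. 1 \<le> \<mu> i} \<in> sets P" for i
    by (rule borel_measurable_le[OF borel_measurable_const measurable_vector_component[OF sets]])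
  then have ge_1: "{\<mu> \<in> space P. \<forall>i\<in>{..<n}. 1 \<le> \<mu> i} \<in> sets P"
    by (intro sets.sets_Collect_finite_All) simp_all
  have "{\<mu> \<in> space P. (1 / real n) * (\<Sum>i<n. ln (\<mu> i) powr p) \<le> \<eta> powr p} \<in> sets P"
    by (intro borel_measurable_le borel_measurable_times borel_measurable_sum borel_measurable_const
        measurable_ln_powr_component[OF sets])
  with ge_1 have "{\<mu> \<in> space P. \<not> ((\<forall>i\<in>{..<n}. 1 \<le> \<mu> i) \<and>
      (1 / real n) * (\<Sum>i<n. ln (\<mu> i) powr p) \<le> \<eta> powr p)} \<in> sets P"
    by (intro sets.sets_Collect_neg sets.sets_Collect_conj)
  then show ?thesis by (simp only: Mset_def Ball_def lessThan_iff mem_Collect_eq)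
qed

theorem le_minimax_risk_add_prob_not_Mset:
  assumes P: "prob_space P" "sets P = sets (vectors n)"
    and bounded: "AE \<mu> in P. \<forall>i<n. 1 \<le> \<mu> i \<and> \<mu> i \<le> T"
    and bayes: "\<And>est. est \<in> estimators n \<Longrightarrow> b \<le> bayes_risk n est P"
  shows "b \<le> minimax_risk n p \<eta> + ennreal ((ln T)\<^sup>2) * emeasure P {\<mu> \<in> space P. \<mu> \<notin> Mset n p \<eta>}"
  unfolding minimax_risk_def
proof (rule le_INF_add_ennreal)
  interpret prob_space P by (rule P)
  fix est assume est: "est \<in> estimators n"
  let ?W = "SUP \<mu>\<in>Mset n p \<eta>. risk n est \<mu>" and ?bad = "{\<mu> \<in> space P. \<mu> \<notin> Mset n p \<eta>}"
  have "b \<le> bayes_risk n (clamp_estimator T est) P"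
    by (intro bayes clamp_estimator_in_estimators est)
  also have "\<dots> \<le> (\<integral>\<^sup>+ \<mu>. ?W + ennreal ((ln T)\<^sup>2) * indicator ?bad \<mu> \<partial>P)"
    unfolding bayes_risk_def
  proof (rule nn_integral_mono_AE, use bounded AE_space in eventually_elim)
    case (elim \<mu>)
    show ?case
    proof (cases "\<mu> \<in> Mset n p \<eta>")
      case True
      have "risk n (clamp_estimator T est) \<mu> \<le> risk n est \<mu>"
        by (rule risk_clamp_estimator_le[OF est]) (use elim in simp)
      also have "\<dots> \<le> ?W" by (rule SUP_upper[OF True])
      finally show ?thesis by (rule add_increasing2[rotated]) simp
    next
      case False
      have "risk n (clamp_estimator T est) \<mu> \<le> ennreal ((ln T)\<^sup>2)"
        by (rule risk_clamp_estimator_le_ln_squared[OF est]) (use elim in simp)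
      then show ?thesis using False elim by (simp add: add_increasing)
    qed
  qed
  also have "\<dots> = ?W + ennreal ((ln T)\<^sup>2) * emeasure P ?bad"
    using sets_not_Mset[OF P(2)]
    by (subst nn_integral_add) (auto simp: nn_integral_cmult_indicator emeasure_space_1)
  finally show "b \<le> ?W + ennreal ((ln T)\<^sup>2) * emeasure P ?bad" .
qed

lemma (in mean_prior) iid_prob_not_Mset_le:
  assumes T: "1 < T" "AE m in \<pi>. m \<le> T" and "0 < p" and n: "0 < n"
    and B: "(\<integral>\<^sup>+ m. ennreal (ln m powr p) \<partial>\<pi>) \<le> ennreal B" "0 \<le> B" "B \<le> \<eta> powr p"
  shows "measure (PiM {..<n} (\<lambda>_. \<pi>)) {\<mu> \<in> space (PiM {..<n} (\<lambda>_. \<pi>)). \<mu> \<notin> Mset n p \<eta>}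
    \<le> exp (- 2 * real n * (\<eta> powr p - B)\<^sup>2 / (ln T powr p)\<^sup>2)"
proof -
  let ?P = "PiM {..<n} (\<lambda>_. \<pi>)" and ?L = "\<lambda>m. ln m powr p"
  interpret P: prob_space ?P by (rule prob_space_PiM) (rule prob_space_axioms)
  have "sets ?P = sets (vectors n)" by (rule sets_PiM_cong) auto
  then have [measurable]: "(\<lambda>\<mu>. \<Sum>i<n. ?L (\<mu> i)) \<in> borel_measurable ?P"
    by (intro borel_measurable_sum measurable_ln_powr_component)
  have "expectation ?L = enn2real (\<integral>\<^sup>+ m. ennreal (?L m) \<partial>\<pi>)"
    by (rule integral_eq_nn_integral) simp_all
  also have "\<dots> \<le> B"
    using enn2real_mono[OF B(1)] B(2) by simp
  finally have "expectation ?L \<le> B" .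
  moreover have "AE \<mu> in ?P. \<forall>i\<in>{..<n}. 1 \<le> \<mu> i"
    using AE_ge_1 by (intro AE_PiM_finite prob_space_axioms) auto
  ultimately have "AE \<mu> in ?P. \<mu> \<notin> Mset n p \<eta> \<longrightarrow>
      expectation ?L + (\<eta> powr p - B) \<le> (\<Sum>i<n. ?L (\<mu> i)) / real n"
    by (auto simp: Mset_def elim!: eventually_mono)
  then have "measure ?P {\<mu> \<in> space ?P. \<mu> \<notin> Mset n p \<eta>} \<le>
      measure ?P {\<mu> \<in> space ?P. expectation ?L + (\<eta> powr p - B) \<le> (\<Sum>i<n. ?L (\<mu> i)) / real n}"
    by (intro P.finite_measure_mono_AE) (auto elim!: eventually_mono)
  also have "\<dots> \<le> exp (- 2 * real n * (\<eta> powr p - B)\<^sup>2 / (ln T powr p - 0)\<^sup>2)"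
  proof (rule Hoeffding_PiM)
    show "AE m in \<pi>. ?L m \<in> {0..ln T powr p}"
      using AE_ge_1 T(2) by eventually_elim (use \<open>0 < p\<close> in \<open>auto intro!: powr_mono2\<close>)
  qed (use n T B(3) in auto)
  finally show ?thesis by simp
qed

theorem min_bayes_risk_le_minimax_risk_add:
  assumes \<pi>: "mean_prior \<pi>" and T: "1 < T" "AE m in \<pi>. m \<le> T" and "0 < p" and n: "0 < n"
    and B: "(\<integral>\<^sup>+ m. ennreal (ln m powr p) \<partial>\<pi>) \<le> ennreal B" "0 \<le> B" "B \<le> \<eta> powr p"
  shows "min_bayes_risk \<pi> \<le> minimax_risk n p \<eta> +
    ennreal ((ln T)\<^sup>2 * exp (- 2 * real n * (\<eta> powr p - B)\<^sup>2 / (ln T powr p)\<^sup>2))"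
proof -
  interpret mean_prior \<pi> by (rule \<pi>)
  let ?P = "PiM {..<n} (\<lambda>_. \<pi>)"
  interpret P: prob_space ?P by (rule prob_space_PiM) (rule prob_space_axioms)
  have "AE \<mu> in ?P. \<forall>i\<in>{..<n}. 1 \<le> \<mu> i \<and> \<mu> i \<le> T"
    using AE_ge_1 T(2) by (intro AE_PiM_finite prob_space_axioms) auto
  then have "min_bayes_risk \<pi> \<le>
      minimax_risk n p \<eta> + ennreal ((ln T)\<^sup>2) * emeasure ?P {\<mu> \<in> space ?P. \<mu> \<notin> Mset n p \<eta>}"
    by (intro le_minimax_risk_add_prob_not_Mset P.prob_space_axioms sets_PiM_cong
        min_bayes_risk_le_bayes_risk_iid \<pi> n) (auto elim!: eventually_mono)
  also have "\<dots> \<le> minimax_risk n p \<eta> +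
      ennreal ((ln T)\<^sup>2) * ennreal (exp (- 2 * real n * (\<eta> powr p - B)\<^sup>2 / (ln T powr p)\<^sup>2))"
    unfolding P.emeasure_eq_measure
    by (intro add_left_mono mult_left_mono ennreal_leI iid_prob_not_Mset_le assms) simp
  finally show ?thesis by (simp add: ennreal_mult)
qed

subsection \<open>Priors with bounded support and slack in the constraint\<close>

definition truncate_prior :: "real \<Rightarrow> real measure \<Rightarrow> real measure" where
  "truncate_prior T \<pi> = distr \<pi> borel (\<lambda>m. if m \<le> T then m else 1)"

context mean_prior
begin

lemma nn_integral_truncate_prior:
  "f \<in> borel_measurable borel \<Longrightarrow>
    (\<integral>\<^sup>+ m. f m \<partial>truncate_prior T \<pi>) = (\<integral>\<^sup>+ m. f (if m \<le> T then m else 1) \<partial>\<pi>)"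
  unfolding truncate_prior_def by (rule nn_integral_distr) simp_all

lemma AE_truncate_prior_le: "1 \<le> T \<Longrightarrow> AE m in truncate_prior T \<pi>. m \<le> T"
  unfolding truncate_prior_def by (subst AE_distr_iff) auto

lemma mean_prior_truncate_prior: "mean_prior (truncate_prior T \<pi>)"
proof -
  have "AE m in truncate_prior T \<pi>. 1 \<le> m"
    unfolding truncate_prior_def using AE_ge_1 by (subst AE_distr_iff) (auto elim!: eventually_mono)
  then show ?thesis
    by (intro mean_priorI) (simp_all add: truncate_prior_def prob_space_distr)
qed

lemma moment_truncate_prior_le:
  "(\<integral>\<^sup>+ m. ennreal (ln m powr p) \<partial>truncate_prior T \<pi>) \<le> (\<integral>\<^sup>+ m. ennreal (ln m powr p) \<partial>\<pi>)"
  by (subst nn_integral_truncate_prior) (auto intro: nn_integral_mono)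

lemma min_bayes_risk_le_truncate_prior:
  assumes A: "0 \<le> A"
  shows "min_bayes_risk \<pi> \<le>
    min_bayes_risk (truncate_prior T \<pi>) + (ln_tail A + near_ln_bound A * emeasure \<pi> {T<..})"
  unfolding min_bayes_risk_def[of "truncate_prior T \<pi>"]
proof (rule le_INF_add_ennreal)
  fix d :: "real \<Rightarrow> real" assume d [measurable]: "d \<in> borel_measurable borel"
  have near: "near_ln A (clamp_rule A d)" by (rule near_ln_clamp_rule[OF d A])
  have "min_bayes_risk \<pi> \<le> scalar_bayes_risk (clamp_rule A d) \<pi>"
    by (rule min_bayes_risk_le[OF near_ln_measurable[OF near]])
  also have "\<dots> \<le>
      (\<integral>\<^sup>+ m. scalar_risk d (if m \<le> T then m else 1) +
        (ln_tail A + near_ln_bound A * indicator {T<..} m) \<partial>\<pi>)"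
    unfolding scalar_bayes_risk_def
  proof (rule nn_integral_mono_AE, use AE_pos in eventually_elim)
    case (elim m)
    then show ?case
      using scalar_risk_clamp_rule_le[OF elim A d] scalar_risk_near_ln_le[OF near elim]
      by (cases "m \<le> T") (simp_all add: add_increasing)
  qed
  also have "\<dots> =
      scalar_bayes_risk d (truncate_prior T \<pi>) + (ln_tail A + near_ln_bound A * emeasure \<pi> {T<..})"
    unfolding scalar_bayes_risk_def using emeasure_space_1
    by (simp add: nn_integral_add nn_integral_cmult_indicator nn_integral_truncate_prior)
  finally show "min_bayes_risk \<pi> \<le>
    scalar_bayes_risk d (truncate_prior T \<pi>) + (ln_tail A + near_ln_bound A * emeasure \<pi> {T<..})" .
qed

lemma emeasure_greaterThan_tendsto_0: "(\<lambda>k. emeasure \<pi> {real k<..}) \<longlonglongrightarrow> 0"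
proof -
  have "measure \<pi> {real k<..} = 1 - cdf \<pi> (real k)" for k
    using prob_compl[of "{..real k}"] by (simp add: cdf_def Compl_eq_Diff_UNIV[symmetric])
  then have "(\<lambda>k. measure \<pi> {real k<..}) \<longlonglongrightarrow> 1 - 1"
    using tendsto_diff[OF tendsto_const[of 1] cdf_lim_infty_prob] by (simp only:)
  from tendsto_ennrealI[OF this] show ?thesis
    by (simp add: emeasure_eq_measure)
qed

lemma less_min_bayes_risk_truncate_prior:
  assumes "c < min_bayes_risk \<pi>"
  obtains T where "1 < T" "c < min_bayes_risk (truncate_prior T \<pi>)"
proof -
  have "(\<lambda>j. c + ln_tail (real j)) \<longlonglongrightarrow> c + 0"
    by (intro tendsto_add tendsto_const ln_tail_tendsto_0)
  then have "\<forall>\<^sub>F j in sequentially. c + ln_tail (real j) < min_bayes_risk \<pi>"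
    by (rule order_tendstoD) (use assms in simp)
  then obtain j where j: "c + ln_tail (real j) < min_bayes_risk \<pi>"
    using eventually_happens'[OF sequentially_bot] by blast
  have "(\<lambda>k. c + (ln_tail (real j) + near_ln_bound (real j) * emeasure \<pi> {real k<..}))
      \<longlonglongrightarrow> c + (ln_tail (real j) + near_ln_bound (real j) * 0)"
    using near_ln_bound_finite
    by (intro tendsto_add tendsto_const ennreal_tendsto_cmult emeasure_greaterThan_tendsto_0) simp
  then have "\<forall>\<^sub>F k in sequentially.
      c + (ln_tail (real j) + near_ln_bound (real j) * emeasure \<pi> {real k<..}) < min_bayes_risk \<pi>"
    by (rule order_tendstoD) (use j in simp)
  with eventually_gt_at_top[of 1] obtain k where k: "1 < k"
    "c + (ln_tail (real j) + near_ln_bound (real j) * emeasure \<pi> {real k<..}) < min_bayes_risk \<pi>"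
    using eventually_happens'[OF sequentially_bot eventually_conj] by blast
  have "c < min_bayes_risk (truncate_prior (real k) \<pi>)"
  proof (rule ccontr)
    assume "\<not> c < min_bayes_risk (truncate_prior (real k) \<pi>)"
    then have "min_bayes_risk \<pi> \<le>
        c + (ln_tail (real j) + near_ln_bound (real j) * emeasure \<pi> {real k<..})"
      by (intro order_trans[OF min_bayes_risk_le_truncate_prior[of "real j" "real k"]]
          add_right_mono) simp_all
    with k(2) show False by simp
  qed
  then show ?thesis using k(1) by (intro that[of "real k"]) simp_all
qed

end

lemma bounded_prior_with_slack:
  assumes \<pi>: "\<pi> \<in> moment_priors p \<eta>" and "0 < \<eta>" and c_less: "c < min_bayes_risk \<pi>"
  obtains \<rho> T B where "mean_prior \<rho>" "1 < T" "AE m in \<rho>. m \<le> T"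
    "(\<integral>\<^sup>+ m. ennreal (ln m powr p) \<partial>\<rho>) \<le> ennreal B" "0 \<le> B" "B < \<eta> powr p" "c < min_bayes_risk \<rho>"
proof -
  interpret P: mean_prior \<pi> by (rule mean_prior_moment_priors[OF \<pi>])
  obtain T where T: "1 < T" "c < min_bayes_risk (truncate_prior T \<pi>)"
    using P.less_min_bayes_risk_truncate_prior[OF c_less] .
  obtain s where s: "0 < s" "s < 1" "c < ennreal s * min_bayes_risk (truncate_prior T \<pi>)"
    using less_mult_ennrealE[OF T(2)] .
  interpret Q: mean_prior "truncate_prior T \<pi>" by (rule P.mean_prior_truncate_prior)
  interpret R: mean_prior "return borel 1" by (rule mean_prior_return) simp
  have s01: "1 - s \<in> {0..1}" using s by simp
  note mean_priors = R.mean_prior_axioms Q.mean_prior_axioms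
  let ?\<rho> = "mix (1 - s) (return borel 1) (truncate_prior T \<pi>)"
  have mean_prior_\<rho>: "mean_prior ?\<rho>" by (rule mean_prior_mix[OF s01 mean_priors])
  have bounded: "AE m in ?\<rho>. m \<le> T"
    using T(1)
    by (intro AE_mix[OF R.prob_space_axioms Q.prob_space_axioms R.events_eq_borel Q.events_eq_borel s01])
       (simp_all add: AE_return P.AE_truncate_prior_le)
  have "(\<integral>\<^sup>+ m. ennreal (ln m powr p) \<partial>?\<rho>) =
      ennreal s * (\<integral>\<^sup>+ m. ennreal (ln m powr p) \<partial>truncate_prior T \<pi>)"
    by (simp add: nn_integral_mix_prior[OF s01 mean_priors] nn_integral_return)
  also have "\<dots> \<le> ennreal s * ennreal (\<eta> powr p)"
    using \<pi>
    by (intro mult_left_mono order_trans[OF P.moment_truncate_prior_le])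
       (simp_all add: moment_priors_def)
  also have "\<dots> = ennreal (s * \<eta> powr p)"
    using s by (simp add: ennreal_mult)
  finally have moment: "(\<integral>\<^sup>+ m. ennreal (ln m powr p) \<partial>?\<rho>) \<le> ennreal (s * \<eta> powr p)" .
  have "c < ennreal (1 - s) * min_bayes_risk (return borel 1) +
      ennreal (1 - (1 - s)) * min_bayes_risk (truncate_prior T \<pi>)"
    using s(3) by (simp add: add_increasing less_le_trans)
  also have "\<dots> \<le> min_bayes_risk ?\<rho>"
    by (rule min_bayes_risk_mix_ge[OF s01 mean_priors])
  finally show ?thesis
    using s \<open>0 < \<eta>\<close> by (intro that[OF mean_prior_\<rho> T(1) bounded moment]) auto
qed

subsection \<open>Limits of the minimax risks\<close>

theorem minimax_risk_eventually_greater: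
  assumes \<pi>: "\<pi> \<in> moment_priors p \<eta>" and "0 < p" "0 < \<eta>" and c_less: "c < min_bayes_risk \<pi>"
  shows "\<forall>\<^sub>F n in sequentially. c < minimax_risk n p \<eta>"
proof -
  obtain \<rho> T B where \<rho>: "mean_prior \<rho>" and T: "1 < T" "AE m in \<rho>. m \<le> T"
    and B: "(\<integral>\<^sup>+ m. ennreal (ln m powr p) \<partial>\<rho>) \<le> ennreal B" "0 \<le> B" "B < \<eta> powr p"
    and c_less_\<rho>: "c < min_bayes_risk \<rho>"
    by (rule bounded_prior_with_slack[OF \<pi> \<open>0 < \<eta>\<close> c_less])
  define r where "r n = (ln T)\<^sup>2 * exp (- 2 * real n * (\<eta> powr p - B)\<^sup>2 / (ln T powr p)\<^sup>2)" for n
  have r_eq: "r n = (ln T)\<^sup>2 * exp (- 2 * (\<eta> powr p - B)\<^sup>2 / (ln T powr p)\<^sup>2) ^ n" for n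
    unfolding r_def by (simp add: exp_of_nat_mult[symmetric])
  have "0 < 2 * (\<eta> powr p - B)\<^sup>2 / (ln T powr p)\<^sup>2"
    using B(3) T by (intro divide_pos_pos mult_pos_pos zero_less_power) auto
  then have "r \<longlonglongrightarrow> (ln T)\<^sup>2 * 0"
    unfolding r_eq[abs_def] by (intro tendsto_mult tendsto_const LIMSEQ_power_zero) simp
  then have "(\<lambda>n. c + ennreal (r n)) \<longlonglongrightarrow> c + ennreal ((ln T)\<^sup>2 * 0)"
    by (intro tendsto_add tendsto_const tendsto_ennrealI)
  then have "\<forall>\<^sub>F n in sequentially. c + ennreal (r n) < min_bayes_risk \<rho>"
    by (rule order_tendstoD) (use c_less_\<rho> in simp)
  then show ?thesis
    using eventually_gt_at_top[of "0::nat"]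
  proof eventually_elim
    case (elim n)
    have "c + ennreal (r n) < minimax_risk n p \<eta> + ennreal (r n)"
      using elim(1)
        min_bayes_risk_le_minimax_risk_add[OF \<rho> T \<open>0 < p\<close> elim(2) B(1,2) less_imp_le[OF B(3)]]
      unfolding r_def by (rule less_le_trans)
    then show ?case by (meson add_right_mono not_le)
  qed
qed

theorem minimax_risk_tendsto:
  assumes "0 < p" "0 < \<eta>" and lf: "least_favourable (moment_priors p \<eta>) \<pi>"
  shows "(\<lambda>n. minimax_risk n p \<eta>) \<longlonglongrightarrow> min_bayes_risk \<pi>"
proof (rule order_tendstoI)
  show "\<forall>\<^sub>F n in sequentially. c < minimax_risk n p \<eta>" if "c < min_bayes_risk \<pi>" for c
    by (rule minimax_risk_eventually_greater[OF least_favourable_mem[OF lf] assms(1,2) that])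
  fix c assume "min_bayes_risk \<pi> < c"
  show "\<forall>\<^sub>F n in sequentially. minimax_risk n p \<eta> < c"
    using eventually_gt_at_top[of "0::nat"]
  proof eventually_elim
    case (elim n)
    note minimax_risk_le_minimax_bayes_risk[OF elim]
    also note minimax_bayes_risk_le_least_favourable[OF elim lf]
    finally show ?case using \<open>min_bayes_risk \<pi> < c\<close> by (rule le_less_trans)
  qed
qed

theorem minimax_bayes_risk_tendsto:
  assumes "0 < p" "0 < \<eta>" and lf: "least_favourable (moment_priors p \<eta>) \<pi>"
  shows "(\<lambda>n. minimax_bayes_risk n p \<eta>) \<longlonglongrightarrow> min_bayes_risk \<pi>"
proof (rule tendsto_sandwich[OF _ _ minimax_risk_tendsto[OF assms] tendsto_const])
  show "\<forall>\<^sub>F n in sequentially. minimax_risk n p \<eta> \<le> minimax_bayes_risk n p \<eta>"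
    using eventually_gt_at_top[of "0::nat"] by eventually_elim (rule minimax_risk_le_minimax_bayes_risk)
  show "\<forall>\<^sub>F n in sequentially. minimax_bayes_risk n p \<eta> \<le> min_bayes_risk \<pi>"
    using eventually_gt_at_top[of "0::nat"]
    by eventually_elim (rule minimax_bayes_risk_le_least_favourable[OF _ lf])
qed

theorem theorem2p1:
  fixes p \<eta> :: real
  assumes "0 < p" and "p < 2" and "0 < \<eta>"
  shows "(\<lambda>n. enn2real (minimax_risk n p \<eta>) / enn2real (minimax_bayes_risk n p \<eta>))
           \<longlonglongrightarrow> 1"
proof -
  obtain \<pi> where lf: "least_favourable (moment_priors p \<eta>) \<pi>"
    using least_favourable_moment_priors_exists[OF \<open>0 < p\<close>] .
  then have "mean_prior \<pi>"
    by (rule mean_prior_moment_priors[OF least_favourable_mem])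
  then obtain b where b: "min_bayes_risk \<pi> = ennreal b" "0 < b"
    using least_favourable_moment_priors_pos[OF \<open>0 < \<eta>\<close> lf] mean_prior.min_bayes_risk_finite[of \<pi>]
    by (cases "min_bayes_risk \<pi>") auto
  have "(\<lambda>n. enn2real (minimax_risk n p \<eta>)) \<longlonglongrightarrow> b"
    using minimax_risk_tendsto[OF \<open>0 < p\<close> \<open>0 < \<eta>\<close> lf] b by (intro tendsto_enn2real) simp_all
  moreover have "(\<lambda>n. enn2real (minimax_bayes_risk n p \<eta>)) \<longlonglongrightarrow> b"
    using minimax_bayes_risk_tendsto[OF \<open>0 < p\<close> \<open>0 < \<eta>\<close> lf] b by (intro tendsto_enn2real) simp_all
  ultimately have "(\<lambda>n. enn2real (minimax_risk n p \<eta>) / enn2real (minimax_bayes_risk n p \<eta>)) \<longlonglongrightarrow> b / b"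
    using b(2) by (intro tendsto_divide) simp_all
  then show ?thesis using b(2) by simp
qed

end
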